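(* Let $k\geqslant 3$ be an integer and let $A=\{0=a_{0}<a_{1}<\cdots<a_{k-1}=2k-3\}$ be a set of $k$ integers. Then $|2^{\wedge}A|=3k-7$ if and only if $k\geqslant 4$ and one of the following cases holds: (a) $A=[0,\theta-k+1]\cup[\theta,2k-3]$ for some integer $\theta$ with $k\leqslant\theta\leqslant 2k-4$; (b) $A=\{2i,\,2j-1: i\in[0,\theta],\ j\in[\theta+1,k-1]\}$ for some integer $\theta$ with $1\leqslant\theta\leqslant k-3$; (c) $3\nmid k$ and $A=\{3i,\,3j-k: i\in[0,\theta],\ j\in[\theta+1,k-1]\}$ for some integer $\theta$ with $\frac{k-3}{3}<\theta<\frac{2k-3}{3}$; (d) $2\mid k$ and $A=\left\{0,\,4i,\,4i-3,\,2k-3: 1\leqslant i\leqslant\frac{k-2}{2}\right\}$; (e) $3\mid k$ and $A=\left\{3i: 0\leqslant i\leqslant\frac{2k-3}{3}\right\}\cup\left\{\theta+3i: 0\leqslant i\leqslant\frac{k-3}{3}\right\}$ for some integer $\theta$ with $1\leqslant\theta\leqslant k-1$ and $3\nmid\theta$; (f) $A$ is one of the following sets: $\{0,1,4,5,6,9\}$, $\{0,3,4,5,8,9\}$, $\{0,1,2,5,6,7,11\}$, $\{0,1,3,4,7,8,11\}$, $\{0,1,4,5,6,10,11\}$, $\{0,1,4,5,7,8,11\}$, $\{0,1,5,6,7,10,11\}$, $\{0,3,4,6,7,10,11\}$, $\{0,3,4,7,8,10,11\}$, $\{0,4,5,6,9,10,11\}$, $\{0,1,2,6,7,8,12,13\}$,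 $\{0,1,4,5,6,9,10,13\}$, $\{0,1,5,6,7,8,12,13\}$, $\{0,1,5,6,7,11,12,13\}$, $\{0,2,3,5,7,8,10,13\}$, $\{0,2,3,5,8,10,11,13\}$, $\{0,3,4,7,8,9,12,13\}$, $\{0,3,5,6,8,10,11,13\}$, $\{5i,\,5i+\theta,\,15: i=0,1,2\}\cup\{5-\theta,\,10-\theta\}$ for some integer $1\leqslant\theta\leqslant 4$, $\{5i,\,5i+\theta,\,15: i=0,1,2\}\cup\{10-\theta,\,15-\theta\}$ for some integer $1\leqslant\theta\leqslant 4$, $\{0,1,2,6,7,8,9,14,15\}$, $\{0,1,4,5,7,8,11,12,15\}$, $\{0,1,6,7,8,9,13,14,15\}$, $\{0,3,4,7,8,10,11,14,15\}$, $\{0,1,2,7,8,9,10,15,16,17\}$, $\{0,1,5,6,7,10,11,12,16,17\}$, $\{0,2,3,5,7,8,10,12,15,17\}$, $\{0,2,5,7,9,10,12,14,15,17\}$, $\{0,3,4,6,7,10,11,13,14,17\}$.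
   Context: For a set $A$ of integers, $2^{\wedge}A=\{a+b: a,b\in A,\ a\neq b\}$ is the set of all sums of two distinct elements of $A$. For integers $a,b$, $[a,b]=\{x\in\mathbb{Z}: a\leqslant x\leqslant b\}$. In set-builder expressions such as $\{2i,2j-1: i\in I, j\in J\}$ the set consists of all listed values as the indices range over the indicated ranges of integers. *)

theory Defs
  imports Complex_Main
begin

definition restricted_sumset :: "int set \<Rightarrow> int set" where
  "restricted_sumset A = {a + b | a b. a \<in> A \<and> b \<in> A \<and> a \<noteq> b}"

text \<open>The exceptional sets. No parameter \<open>k\<close> appears: a set in this collection can only be
  the set \<open>A\<close> of the theorem for the one value of \<open>k\<close> equal to its cardinality.\<close>

definition exceptional_sets :: "int set set" where
  "exceptional_sets =
    {{0,1,4,5,6,9}, {0,3,4,5,8,9}, {0,1,2,5,6,7,11},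
     {0,1,3,4,7,8,11}, {0,1,4,5,6,10,11}, {0,1,4,5,7,8,11},
     {0,1,5,6,7,10,11}, {0,3,4,6,7,10,11}, {0,3,4,7,8,10,11},
     {0,4,5,6,9,10,11}, {0,1,2,6,7,8,12,13}, {0,1,4,5,6,9,10,13},
     {0,1,5,6,7,8,12,13}, {0,1,5,6,7,11,12,13}, {0,2,3,5,7,8,10,13},
     {0,2,3,5,8,10,11,13}, {0,3,4,7,8,9,12,13}, {0,3,5,6,8,10,11,13}}
    \<union> {{5 * i | i. i \<in> {0,1,2}} \<union> {5 * i + \<theta> | i. i \<in> {0,1,2}} \<union> {15} \<union> {5 - \<theta>, 10 - \<theta>}
        | \<theta>. 1 \<le> \<theta> \<and> \<theta> \<le> 4}
    \<union> {{5 * i | i. i \<in> {0,1,2}} \<union> {5 * i + \<theta> | i. i \<in> {0,1,2}} \<union> {15} \<union> {10 - \<theta>, 15 - \<theta>}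
        | \<theta>. 1 \<le> \<theta> \<and> \<theta> \<le> 4}
    \<union> {{0,1,2,6,7,8,9,14,15}, {0,1,4,5,7,8,11,12,15},
       {0,1,6,7,8,9,13,14,15}, {0,3,4,7,8,10,11,14,15},
       {0,1,2,7,8,9,10,15,16,17}, {0,1,5,6,7,10,11,12,16,17},
       {0,2,3,5,7,8,10,12,15,17}, {0,2,5,7,9,10,12,14,15,17},
       {0,3,4,6,7,10,11,13,14,17}}"

end

theory Submission
  imports Defs "HOL-Number_Theory.Cong"
begin

text \<open>
  Write \<open>l = 2 k - 3\<close> for the largest element of \<open>A\<close>, and let \<open>T\<close> be the set of integers congruent
  to an element of \<open>A\<close> modulo \<open>l\<close>. Since \<open>0\<close> and \<open>l\<close> coincide modulo \<open>l\<close>, the set \<open>T\<close> fills \<open>(l + 1) div 2\<close>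
  of the \<open>l\<close> residue classes, so by the pigeonhole principle every \<open>c\<close> has the form \<open>x + y\<close> with \<open>x\<close> and \<open>y\<close>
  in \<open>T\<close>. The sumset contains \<open>l\<close>, and for each \<open>c\<close> in \<open>A\<close> with \<open>0 < c < l\<close> it contains both \<open>c\<close> and
  \<open>c + l\<close>; this gives \<open>2 k - 3\<close> elements. The \<open>k - 2\<close> gaps \<open>c\<close> of \<open>A\<close> below \<open>l\<close> contribute one element each,
  except that a gap contributes none if the only solution of \<open>x + y = c\<close> in \<open>T\<close> modulo \<open>l\<close> has \<open>x = y\<close>, and
  two if some representations of it with \<open>x \<noteq> y\<close> wrap around modulo \<open>l\<close> and some do not. So the cardinality
  is \<open>3 k - 5\<close>, minus the number of unrepresented gaps, plus the number of double gaps.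

  An unrepresented \<open>c = 2 h\<close> forces the reflection \<open>x \<mapsto> 2 h - x\<close> to exchange \<open>T\<close> with its
  complement, up to the fixed point \<open>h\<close> (\<open>unrepresented_imp_centre\<close>). Two such centres \<open>h\<close> and \<open>h + e\<close>
  determine \<open>T\<close> almost completely: with \<open>g = gcd e l\<close>, the set \<open>T\<close> is a union of classes modulo \<open>g\<close>
  and of about half of the class of \<open>h\<close>, which is a progression with difference \<open>2 e\<close>. There is no third
  centre (\<open>at_most_two_centres\<close>). Hence the cardinality is \<open>3 k - 7\<close> exactly if there are two
  unrepresented gaps and no double gap.

  The absence of double gaps is a statement about carries. If \<open>g = 1\<close>, then \<open>T\<close> consists of the residues
  of \<open>i * d\<close> with \<open>- u \<le> i \<le> v\<close>, where \<open>u + v = k - 2\<close>, and one may take \<open>u \<le> v\<close>. For \<open>v \<ge> 6\<close> the carries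
  turn the residues of \<open>i * d\<close> with \<open>1 \<le> i \<le> v\<close> into an arithmetic
  progression of integers (\<open>long_dilated_interval\<close>). Then \<open>d\<close> may be replaced by a
  representative with \<open>\<bar>d\<bar> * v < l\<close>, hence \<open>\<bar>d\<bar> \<le> 4\<close>, and
  the values \<open>1, 2, 3, 4\<close> give the first four families. The finitely many cases with \<open>v
  \<le> 5\<close> yield sporadic sets in addition. If \<open>g > 1\<close>, a class disjoint from
  \<open>T\<close> that is a sum of two classes meeting \<open>T\<close> nearly always contains a double
  gap. This leaves only \<open>g = 3\<close>, which is the fifth family, and \<open>g = 5\<close> with
  \<open>l = 15\<close> (\<open>g_cases\<close>), which gives the sporadic sets with a parameter.
  Conversely, in each family two unrepresented gaps can be named and the carries computed; the sporadic sets
  are evaluated.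
\<close>

section \<open>Unrepresented residues and centres of symmetry\<close>

definition periodic :: "int \<Rightarrow> int set \<Rightarrow> bool" where
  "periodic l T \<longleftrightarrow> (\<forall>x y. [x = y] (mod l) \<longrightarrow> (x \<in> T \<longleftrightarrow> y \<in> T))"

text \<open>The shape that a set of \<open>(l + 1) div 2\<close> residues has when \<open>2 h\<close> is not a sum of two different ones.\<close>

definition centre :: "int \<Rightarrow> int set \<Rightarrow> int \<Rightarrow> bool" where
  "centre l T h \<longleftrightarrow> h \<in> T \<and> (\<forall>x. \<not> [x = h] (mod l) \<longrightarrow> (x \<in> T \<longleftrightarrow> 2 * h - x \<notin> T))"

text \<open>Equality of the two summands is allowed: for the sets considered here a solution always exists.\<close>

definition unrepresented :: "int \<Rightarrow> int set \<Rightarrow> int \<Rightarrow> bool" where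
  "unrepresented l T c \<longleftrightarrow> (\<forall>x\<in>T. c - x \<in> T \<longrightarrow> [2 * x = c] (mod l))"

lemma periodicD: "periodic l T \<Longrightarrow> [x = y] (mod l) \<Longrightarrow> x \<in> T \<longleftrightarrow> y \<in> T"
  by (auto simp: periodic_def)

lemma periodic_mod: "periodic l T \<Longrightarrow> x mod l \<in> T \<longleftrightarrow> x \<in> T"
  by (rule periodicD) (auto simp: cong_def)

lemma cong_double_cancel:
  fixes l :: int
  assumes "odd l"
  shows "[2 * x = 2 * y] (mod l) \<longleftrightarrow> [x = y] (mod l)"
proof -
  have "coprime 2 l" using assms by simp
  then show ?thesis by (rule cong_mult_lcancel)
qed

lemma cong_diff_cancel_left:
  fixes l :: int
  shows "[c - x = c - y] (mod l) \<longleftrightarrow> [x = y] (mod l)"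
  by (simp add: cong_iff_dvd_diff dvd_diff_commute)

lemma eq_of_cong_residues:
  fixes l :: int
  assumes "[x = y] (mod l)" "0 \<le> x" "x < l" "0 \<le> y" "y < l"
  shows "x = y"
  using assms by (simp add: cong_def)

text \<open>The residues of \<open>T\<close> and of \<open>c - T\<close> are too many to be disjoint. A common residue is a half of \<open>c\<close>,
  which is unique for odd \<open>l\<close>. So they share exactly one residue, and then together they fill all \<open>l\<close> classes.\<close>

lemma unrepresented_imp_centre:
  assumes l: "odd l" "l > 0" and per: "periodic l T"
    and card: "2 * int (card (T \<inter> {0..<l})) = l + 1"
    and unrep: "unrepresented l T c"
  obtains h where "[2 * h = c] (mod l)" "centre l T h"
proof -
  have norep: "[a = b] (mod l)" if "a \<in> T" "b \<in> T" "[a + b = c] (mod l)" for a b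
  proof -
    have "[a + b - a = c - a] (mod l)" using that(3) cong_refl by (rule cong_diff)
    then have "[b = c - a] (mod l)" by simp
    then have "c - a \<in> T" using that(2) periodicD[OF per] by blast
    then have "[a + a = c] (mod l)" using that(1) unrep by (simp add: unrepresented_def)
    then have "[a + a = a + b] (mod l)" using that(3) cong_sym cong_trans by blast
    then show ?thesis by (simp only: cong_add_lcancel)
  qed
  define S where "S = T \<inter> {0..<l}"
  define f where "f x = (c - x) mod l" for x
  have f_range: "f x \<in> {0..<l}" for x using l by (simp add: f_def)
  have f_cong: "[f x = c - x] (mod l)" for x by (simp add: f_def cong_def)
  have sum_cong: "[x + f x = c] (mod l)" for x
    using cong_add[OF cong_refl[of x] f_cong[of x]] by simp
  have fin: "finite S" by (simp add: S_def)
  have inj: "inj_on f S"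
  proof (rule inj_onI)
    fix x y assume xy: "x \<in> S" "y \<in> S" "f x = f y"
    then have "[c - x = c - y] (mod l)" by (simp add: f_def cong_def)
    then have "[x = y] (mod l)" by (simp only: cong_diff_cancel_left)
    then show "x = y" using xy by (auto intro: eq_of_cong_residues simp: S_def)
  qed
  have cardS: "2 * int (card S) = l + 1" using card by (simp add: S_def)
  have cardfS: "card (f ` S) = card S" using inj by (rule card_image)
  have sub: "S \<union> f ` S \<subseteq> {0..<l}" using f_range by (auto simp: S_def)
  have un_le: "int (card (S \<union> f ` S)) \<le> l"
    using card_mono[OF _ sub] l by simp
  have un: "card (S \<union> f ` S) + card (S \<inter> f ` S) = 2 * card S"
    using card_Un_Int[OF fin finite_imageI[OF fin, of f]] cardfS by simp
  have double: "[2 * x = c] (mod l)" if "x \<in> S \<inter> f ` S" for x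
  proof -
    from that obtain y where y: "y \<in> S" "x = f y" by auto
    then have "[y + x = c] (mod l)" using sum_cong by simp
    moreover have "[y = x] (mod l)"
      using norep[of y x] y that sum_cong by (auto simp: S_def)
    ultimately show ?thesis
      by (metis cong_add_rcancel cong_sym cong_trans mult_2)
  qed
  have "S \<inter> f ` S \<noteq> {}"
  proof
    assume "S \<inter> f ` S = {}"
    then have "card (S \<inter> f ` S) = 0" by simp
    then show False using un un_le cardS by linarith
  qed
  then obtain h where h: "h \<in> S \<inter> f ` S" by blast
  have "S \<inter> f ` S = {h}"
  proof -
    have "x = h" if "x \<in> S \<inter> f ` S" for x
    proof -
      have "[2 * x = 2 * h] (mod l)" using double[OF that] double[OF h] by (metis cong_sym cong_trans)
      then have "[x = h] (mod l)" using l(1) by (simp add: cong_double_cancel)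
      then show ?thesis using that h by (auto intro: eq_of_cong_residues simp: S_def)
    qed
    then show ?thesis using h by blast
  qed
  then have "card (S \<inter> f ` S) = 1" by simp
  then have "int (card (S \<union> f ` S)) = l" using un cardS by linarith
  then have all: "S \<union> f ` S = {0..<l}"
    using card_subset_eq[OF _ sub] l by simp
  have "centre l T h"
    unfolding centre_def
  proof (intro conjI allI impI)
    show "h \<in> T" using h by (simp add: S_def)
    fix x assume x: "\<not> [x = h] (mod l)"
    have hc: "[2 * h - x = c - x] (mod l)" using double[OF h] by (rule cong_diff) simp
    have *: "[x + (2 * h - x) = c] (mod l)" using double[OF h] by simp
    show "x \<in> T \<longleftrightarrow> 2 * h - x \<notin> T"
    proof
      assume "x \<in> T"
      show "2 * h - x \<notin> T"
      proof
        assume "2 * h - x \<in> T"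
        then have "[x = 2 * h - x] (mod l)" using norep[OF \<open>x \<in> T\<close> _ *] by simp
        then have "[x + x = (2 * h - x) + x] (mod l)" by (rule cong_add) simp
        then have "[2 * x = 2 * h] (mod l)" by simp
        then show False using x l by (simp add: cong_double_cancel)
      qed
    next
      assume nT: "2 * h - x \<notin> T"
      then have "(2 * h - x) mod l \<notin> S" using periodic_mod[OF per] by (simp add: S_def)
      moreover have "(2 * h - x) mod l \<in> {0..<l}" using l by simp
      ultimately obtain y where y: "y \<in> S" "(2 * h - x) mod l = f y" using all by blast
      have "[2 * h - x = f y] (mod l)" using y(2) by (metis cong_mod_left cong_refl)
      then have "[c - x = c - y] (mod l)" using hc f_cong by (metis cong_sym cong_trans)
      then have "[x = y] (mod l)" by (simp only: cong_diff_cancel_left)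
      then show "x \<in> T" using y(1) periodicD[OF per] by (simp add: S_def)
    qed
  qed
  with double[OF h] that show ?thesis by blast
qed

text \<open>The reflection in \<open>h\<close> matches the residues of \<open>T\<close> other than \<open>h\<close> with the residues outside \<open>T\<close>.\<close>

lemma card_centre:
  assumes l: "odd l" "l > 0" and per: "periodic l T" and cen: "centre l T h"
  shows "2 * int (card (T \<inter> {0..<l})) = l + 1"
proof -
  define S where "S = T \<inter> {0..<l}"
  define h0 where "h0 = h mod l" 
  have h0: "h0 \<in> S" using l cen periodic_mod[OF per] by (simp add: S_def h0_def centre_def)
  have nh: "\<not> [x = h] (mod l)" if "x \<in> {0..<l}" "x \<noteq> h0" for x
    using that by (simp add: h0_def cong_def)
  define f where "f x = (2 * h - x) mod l" for x
  have f_range: "f x \<in> {0..<l}" for x using l by (simp add: f_def)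
  have f_T: "f x \<in> T \<longleftrightarrow> 2 * h - x \<in> T" for x by (simp add: f_def periodic_mod[OF per])
  have ff: "f (f x) = x" if "x \<in> {0..<l}" for x
    using that by (simp add: f_def mod_diff_right_eq)
  have flip: "f x \<in> T \<longleftrightarrow> x \<notin> T" if "x \<in> {0..<l}" "x \<noteq> h0" for x
    using cen nh[OF that] f_T by (auto simp: centre_def)
  have fh0: "f h0 = h0" by (simp add: f_def h0_def mod_diff_right_eq)
  have "bij_betw f (S - {h0}) ({0..<l} - S)"
  proof (rule bij_betw_byWitness[where f' = f])
    show "f ` (S - {h0}) \<subseteq> {0..<l} - S" using f_range flip by (auto simp: S_def)
    show "f ` ({0..<l} - S) \<subseteq> S - {h0}"
    proof
      fix y assume "y \<in> f ` ({0..<l} - S)"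
      then obtain x where x: "x \<in> {0..<l} - S" "y = f x" by blast
      then have "x \<noteq> h0" using h0 by auto
      then have "f x \<in> S" using x flip f_range by (auto simp: S_def)
      moreover have "f x \<noteq> h0" using x \<open>x \<noteq> h0\<close> fh0 ff by (metis DiffE)
      ultimately show "y \<in> S - {h0}" using x by simp
    qed
  qed (use ff in \<open>auto simp: S_def\<close>)
  then have "card (S - {h0}) = card ({0..<l} - S)" by (rule bij_betw_same_card)
  moreover have "card (S - {h0}) = card S - 1" using h0 by simp
  moreover have "card ({0..<l} - S) = nat l - card S"
    by (subst card_Diff_subset) (auto simp: S_def)
  moreover have "card S \<le> nat l"
    using card_mono[of "{0..<l}" S] by (auto simp: S_def)
  moreover have "card S > 0" using h0 by (auto simp: card_gt_0_iff S_def)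
  ultimately show ?thesis using l unfolding S_def by linarith
qed

section \<open>Sets with two centres\<close>

text \<open>The product of the reflections in the two centres is the translation by \<open>2 * e\<close>, so this translation
  preserves \<open>T\<close> except where one of the centres interferes. The translation moves inside the classes
  modulo \<open>gcd e l\<close>; only the class of \<open>h\<close> sees the exceptions.\<close>

locale two_centres =
  fixes l :: int and T :: "int set" and h e :: int
  assumes odd_l: "odd l" and l_pos: "l > 0" and per: "periodic l T"
    and cen1: "centre l T h" and cen2: "centre l T (h + e)"
    and distinct: "\<not> l dvd e"
begin

definition g where "g = gcd e l"
definition n where "n = l div g"

lemma g_pos: "g > 0" using l_pos by (simp add: g_def)
lemma g_dvd_l: "g dvd l" and g_dvd_e: "g dvd e" by (simp_all add: g_def)
lemma l_eq: "l = g * n" using g_dvd_l by (simp add: n_def)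
lemma odd_g: "odd g" and odd_n: "odd n" using odd_l even_mult_iff[of g n] by (auto simp flip: l_eq)
lemma n_pos: "n > 0" using l_eq l_pos g_pos by (metis zero_less_mult_pos)

lemma dvd_mult_e_iff: "l dvd t * e \<longleftrightarrow> n dvd t"
proof -
  obtain e' where e': "e = g * e'" using g_dvd_e by blast
  have "gcd (g * e') (g * n) = g" using e' l_eq g_def by simp
  then have "g * gcd e' n = g" using g_pos by (simp add: gcd_mult_left)
  then have "coprime n e'" using g_pos by (simp add: coprime_iff_gcd_eq_1 gcd.commute)
  have "l dvd t * e \<longleftrightarrow> g * n dvd g * (t * e')" using l_eq e' by (simp add: mult.left_commute)
  also have "\<dots> \<longleftrightarrow> n dvd t * e'" using g_pos by simp
  also have "\<dots> \<longleftrightarrow> n dvd t" using \<open>coprime n e'\<close> by (simp add: coprime_dvd_mult_left_iff)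
  finally show ?thesis .
qed

lemma n_ge_3: "n \<ge> 3"
proof -
  have "\<not> n dvd 1" using dvd_mult_e_iff[of 1] distinct by simp
  then have "n \<noteq> 1" by auto
  then show ?thesis using odd_n n_pos by presburger
qed

lemma cong_shift_iff: "[h + s * e = h + t * e] (mod l) \<longleftrightarrow> n dvd s - t"
proof -
  have "[h + s * e = h + t * e] (mod l) \<longleftrightarrow> l dvd (s - t) * e"
    by (simp add: cong_iff_dvd_diff algebra_simps)
  then show ?thesis by (simp add: dvd_mult_e_iff)
qed

lemma mem_shift:
  assumes "\<not> [x = h] (mod l)" "\<not> [x = h - e] (mod l)"
  shows "x \<in> T \<longleftrightarrow> x + 2 * e \<in> T"
proof -
  have "\<not> [2 * h - x = h + e] (mod l)"
  proof
    assume "[2 * h - x = h + e] (mod l)"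
    then have "[2 * h - x = 2 * h - (h - e)] (mod l)" by simp
    then show False using assms by (simp only: cong_diff_cancel_left)
  qed
  then have "2 * h - x \<in> T \<longleftrightarrow> 2 * (h + e) - (2 * h - x) \<notin> T"
    using cen2 by (simp add: centre_def)
  moreover have "x \<in> T \<longleftrightarrow> 2 * h - x \<notin> T" using cen1 assms by (simp add: centre_def)
  moreover have "2 * (h + e) - (2 * h - x) = x + 2 * e" by simp
  ultimately show ?thesis by metis
qed

text \<open>The walk from \<open>h + e\<close> in steps of \<open>2 * e\<close> stays in \<open>T\<close> until it arrives at \<open>h\<close>, which is
  \<open>h + n * e\<close> modulo \<open>l\<close>.\<close>

lemma odd_shift_mem:
  assumes "odd t" "1 \<le> t" "t \<le> n"
  shows "h + t * e \<in> T"
proof -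
  have "h + (2 * int j + 1) * e \<in> T" if "2 * int j + 1 \<le> n" for j
    using that
  proof (induction j)
    case 0
    then show ?case using cen2 by (simp add: centre_def)
  next
    case (Suc j)
    define x where "x = h + (2 * int j + 1) * e"
    have xT: "x \<in> T" using Suc by (simp add: x_def)
    have "\<not> n dvd 2 * int j + 1" "\<not> n dvd 2 * int j + 2"
      using Suc.prems n_ge_3 by (auto dest!: zdvd_imp_le)
    then have "\<not> [x = h] (mod l)" "\<not> [x = h - e] (mod l)"
      using cong_shift_iff[of "2 * int j + 1" 0] cong_shift_iff[of "2 * int j + 1" "-1"]
      by (simp_all add: x_def add.commute)
    then have "x + 2 * e \<in> T" using mem_shift xT by simp
    then show ?case by (simp add: x_def algebra_simps)
  qed
  from this[of "nat (t div 2)"] show ?thesis using assms by (auto elim!: oddE)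
qed

text \<open>Modulo \<open>n\<close>, reflection in \<open>h\<close> exchanges \<open>t\<close> with \<open>n - t\<close>, which is odd for even \<open>t\<close>.\<close>

lemma even_shift_not_mem:
  assumes "even t" "1 \<le> t" "t < n"
  shows "h + t * e \<notin> T"
proof -
  have "\<not> n dvd t" using assms by (auto dest: zdvd_imp_le)
  then have "\<not> [h + t * e = h] (mod l)" using cong_shift_iff[of t 0] by simp
  then have "h + t * e \<in> T \<longleftrightarrow> 2 * h - (h + t * e) \<notin> T" using cen1 by (simp add: centre_def)
  moreover have "[2 * h - (h + t * e) = h + (n - t) * e] (mod l)"
    using cong_shift_iff[of "-t" "n - t"] by simp
  moreover have "h + (n - t) * e \<in> T" using assms odd_n by (intro odd_shift_mem) auto
  ultimately show ?thesis using periodicD[OF per] by blast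
qed

lemma cong_g_if_cong_l: "[x = y] (mod l) \<Longrightarrow> [x = y] (mod g)"
  using cong_dvd_modulus g_dvd_l by blast

lemma dvd_g_shift:
  assumes "[x = h] (mod g)"
  obtains t where "1 \<le> t" "t \<le> n" "[x = h + t * e] (mod l)"
proof -
  obtain s where s: "[e * s = g] (mod l)"
    using cong_solve_int[of e l] g_def by metis
  obtain r where r: "x - h = g * r" using assms by (auto simp: cong_iff_dvd_diff)
  define t where "t = (s * r - 1) mod n + 1"
  have "n dvd (s * r - 1) - (s * r - 1) mod n" by (rule dvd_minus_mod)
  then have "n dvd - (t - s * r)" by (simp add: t_def algebra_simps)
  then have "n dvd t - s * r" by (simp only: dvd_minus_iff)
  then have "l dvd (t - s * r) * e" using dvd_mult_e_iff by simp
  moreover have "l dvd (e * s - g) * r" using s by (simp add: cong_iff_dvd_diff)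
  ultimately have "l dvd (t - s * r) * e + (e * s - g) * r" by (rule dvd_add)
  then have "l dvd h + t * e - x" using r by (simp add: algebra_simps)
  then have "[x = h + t * e] (mod l)" by (simp add: cong_iff_dvd_diff dvd_diff_commute)
  moreover have "1 \<le> t" "t \<le> n"
    using pos_mod_sign[OF n_pos, of "s * r - 1"] pos_mod_bound[OF n_pos, of "s * r - 1"]
    by (simp_all add: t_def)
  ultimately show ?thesis using that by blast
qed

text \<open>Outside the class of \<open>h\<close> the translation by \<open>2 * e\<close> preserves \<open>T\<close>, and since \<open>l\<close> is odd, its iterates
  realise every translation by a multiple of \<open>g\<close> modulo \<open>l\<close>.\<close>

lemma mem_cong_g:
  assumes "\<not> [x = h] (mod g)" "[x = y] (mod g)"
  shows "x \<in> T \<longleftrightarrow> y \<in> T"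
proof -
  have step: "z + 2 * int j * e \<in> T \<longleftrightarrow> z \<in> T" if "\<not> [z = h] (mod g)" for z j
  proof (induction j)
    case (Suc j)
    define w where "w = z + 2 * int j * e"
    have wz: "[w = z] (mod g)" "[w + e = z] (mod g)"
      using g_dvd_e by (simp_all add: w_def cong_iff_dvd_diff)
    have "\<not> [w = h] (mod l)" using wz that by (metis cong_g_if_cong_l cong_sym cong_trans)
    moreover have "\<not> [w = h - e] (mod l)"
    proof
      assume "[w = h - e] (mod l)"
      then have "[w + e = h - e + e] (mod l)" by (rule cong_add) simp
      then have "[w + e = h] (mod g)" by (simp add: cong_g_if_cong_l)
      then show False using wz that by (metis cong_sym cong_trans)
    qed
    ultimately have "w \<in> T \<longleftrightarrow> w + 2 * e \<in> T" by (rule mem_shift)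
    then show ?case using Suc by (simp add: w_def algebra_simps)
  qed simp
  have "gcd (2 * e) l = g"
    using odd_l by (simp add: g_def gcd_mult_left_left_cancel coprime_commute)
  then obtain s where s: "[2 * e * s = g] (mod l)" using cong_solve_int[of "2 * e" l] by metis
  obtain r where r: "y - x = g * r" using assms(2) unfolding cong_iff_dvd_diff by (metis dvdE dvd_diff_commute)
  define j where "j = nat ((s * r) mod l)"
  have j: "[int j = s * r] (mod l)" using l_pos by (simp add: j_def cong_def)
  have "[2 * int j * e = 2 * e * s * r] (mod l)"
    using cong_scalar_left[OF j, of "2 * e"] by (simp add: ac_simps)
  also have "[2 * e * s * r = g * r] (mod l)" using s by (rule cong_scalar_right)
  finally have "[x + 2 * int j * e = x + g * r] (mod l)" by (rule cong_add[OF cong_refl])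
  then have "[x + 2 * int j * e = y] (mod l)" using r by (simp add: algebra_simps)
  then show ?thesis using step[OF assms(1)] periodicD[OF per] by blast
qed

text \<open>A third centre would map one element of \<open>T\<close> to another. In the class of \<open>h\<close> it has the form \<open>h + t * e\<close> with
  \<open>t\<close> odd and strictly between \<open>1\<close> and \<open>n\<close>, and it exchanges the parameters \<open>t - 2\<close> and \<open>t + 2\<close>. In another
  class it exchanges its two neighbours at distance \<open>g\<close>.\<close>

lemma at_most_two_centres:
  assumes "centre l T c"
  shows "[c = h] (mod l) \<or> [c = h + e] (mod l)"
proof (rule ccontr)
  assume neg: "\<not> ?thesis"
  have cT: "c \<in> T" using assms by (simp add: centre_def)
  show False
  proof (cases "[c = h] (mod g)")
    case True
    then obtain t where t: "1 \<le> t" "t \<le> n" "[c = h + t * e] (mod l)" by (rule dvd_g_shift)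
    have "h + t * e \<in> T" using cT t(3) periodicD[OF per] by blast
    then have "odd t \<or> t = n" using even_shift_not_mem t by force
    then have "odd t" using odd_n by auto
    have "t \<noteq> 1" using neg t(3) by auto
    have "[h + n * e = h] (mod l)" using cong_shift_iff[of n 0] by simp
    then have "t \<noteq> n" using neg t(3) cong_trans by blast
    then have t': "3 \<le> t" "t + 2 \<le> n" using t \<open>odd t\<close> odd_n \<open>t \<noteq> 1\<close> by presburger+
    have x: "h + (t + 2) * e \<in> T" and y: "h + (t - 2) * e \<in> T"
      using t' \<open>odd t\<close> by (auto intro!: odd_shift_mem)
    have "\<not> n dvd 2" using n_ge_3 by (auto dest: zdvd_imp_le)
    then have "\<not> [h + (t + 2) * e = h + t * e] (mod l)" using cong_shift_iff[of "t + 2" t] by simp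
    then have "\<not> [h + (t + 2) * e = c] (mod l)" using t(3) cong_trans by blast
    then have "2 * c - (h + (t + 2) * e) \<notin> T" using assms x by (auto simp: centre_def)
    moreover have "[2 * c - (h + (t + 2) * e) = 2 * (h + t * e) - (h + (t + 2) * e)] (mod l)"
      by (rule cong_diff[OF cong_mult[OF cong_refl t(3)] cong_refl])
    moreover have "2 * (h + t * e) - (h + (t + 2) * e) = h + (t - 2) * e" by (simp add: algebra_simps)
    ultimately show False using y periodicD[OF per] by metis
  next
    case False
    have "c + g \<in> T" "c - g \<in> T"
      using cT mem_cong_g[OF False, of "c + g"] mem_cong_g[OF False, of "c - g"]
      by (simp_all add: cong_iff_dvd_diff)
    moreover have "\<not> [c + g = c] (mod l)"
    proof
      assume "[c + g = c] (mod l)"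
      then have "l dvd g" by (simp add: cong_iff_dvd_diff)
      then have "l \<le> g" using g_pos by (rule zdvd_imp_le)
      then have "g * n \<le> g * 1" using l_eq by simp
      then show False using g_pos n_ge_3 by simp
    qed
    ultimately show False using assms by (auto simp: centre_def dest!: spec[of _ "c + g"])
  qed
qed

end

lemma cong_int_bound:
  fixes l :: int
  assumes "[x = y] (mod l)" "\<bar>x - y\<bar> < l"
  shows "x = y"
proof (rule ccontr)
  assume "x \<noteq> y"
  then have "\<bar>l\<bar> \<le> \<bar>x - y\<bar>" using assms(1) by (intro dvd_imp_le_int) (simp_all add: cong_iff_dvd_diff)
  then show False using assms(2) by linarith
qed

section \<open>Residue sets without double gaps\<close>

text \<open>The comparison of \<open>x mod l\<close> with \<open>c mod l\<close> tells whether the sum of the residues of \<open>x\<close> and \<open>c - x\<close> is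
  the residue of \<open>c\<close> or exceeds it by \<open>l\<close>. So the property says that all representations of a missing \<open>c\<close> by
  two different residues produce the same carry.\<close>

definition one_sided :: "int \<Rightarrow> int set \<Rightarrow> bool" where
  "one_sided l T \<longleftrightarrow> (\<forall>c x y. c \<notin> T \<and> x \<in> T \<and> c - x \<in> T \<and> \<not> [2 * x = c] (mod l) \<and>
      y \<in> T \<and> c - y \<in> T \<and> \<not> [2 * y = c] (mod l)
      \<longrightarrow> (x mod l < c mod l \<longleftrightarrow> y mod l < c mod l))"

lemma one_sidedD:
  assumes "one_sided l T"
    and "c \<notin> T" "x \<in> T" "c - x \<in> T" "\<not> [2 * x = c] (mod l)"
      "y \<in> T" "c - y \<in> T" "\<not> [2 * y = c] (mod l)"
  shows "x mod l < c mod l \<longleftrightarrow> y mod l < c mod l"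
  using assms unfolding one_sided_def by blast

text \<open>The situation to be classified. The doubles of the centres are outside \<open>T\<close> because they stand for
  two gaps; a centre whose double lies in \<open>T\<close> does not cost the sumset any element.\<close>

locale extremal = two_centres +
  assumes zero: "0 \<in> T" and end1: "2 * h \<notin> T" and end2: "2 * (h + e) \<notin> T"
    and sided: "one_sided l T"
begin

text \<open>An unrepresented \<open>c\<close> would have a third centre as its half.\<close>

lemma represented:
  assumes "\<not> [c = 2 * h] (mod l)" "\<not> [c = 2 * (h + e)] (mod l)"
  obtains a where "a \<in> T" "c - a \<in> T" "\<not> [2 * a = c] (mod l)"
proof -
  have "\<not> unrepresented l T c"
  proof
    assume "unrepresented l T c"
    then obtain h' where h': "[2 * h' = c] (mod l)" "centre l T h'"
      by (rule unrepresented_imp_centre[OF odd_l l_pos per card_centre[OF odd_l l_pos per cen1]])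
    have "[2 * h' = 2 * h] (mod l) \<or> [2 * h' = 2 * (h + e)] (mod l)"
      using at_most_two_centres[OF h'(2)] by (simp only: cong_double_cancel[OF odd_l])
    then show False using assms h'(1) by (metis cong_sym cong_trans)
  qed
  then show ?thesis using that by (auto simp: unrepresented_def)
qed

lemma not_cong_double:
  assumes "\<not> [x = y] (mod l)"
  shows "\<not> [2 * x = c] (mod l) \<or> \<not> [2 * y = c] (mod l)"
proof (rule ccontr)
  assume "\<not> ?thesis"
  then have "[2 * x = 2 * y] (mod l)" using cong_trans cong_sym by blast
  then show False using assms by (simp only: cong_double_cancel[OF odd_l])
qed

lemma small_mult_not_cong:
  assumes "i < j" "j < i + n"
  shows "\<not> [\<rho> + g * i = \<rho> + g * j] (mod l)"
proof
  assume "[\<rho> + g * i = \<rho> + g * j] (mod l)"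
  then have "g * n dvd g * (i - j)" using l_eq by (simp add: cong_iff_dvd_diff right_diff_distrib)
  then have "n dvd i - j" using g_pos by simp
  then have "n dvd j - i" by (simp only: dvd_diff_commute)
  then have "n \<le> j - i" using assms by (intro zdvd_imp_le) auto
  then show False using assms by simp
qed

lemma class_residue: "[x mod g + g * i = x] (mod g)"
  by (simp add: cong_def)

lemma class_residue_range:
  assumes "0 \<le> i" "i < n"
  shows "0 \<le> x mod g + g * i" "x mod g + g * i < l"
proof -
  have b: "0 \<le> x mod g" "x mod g < g" using g_pos by auto
  then show "0 \<le> x mod g + g * i" using assms g_pos by simp
  have "g * (i + 1) \<le> g * n" using assms g_pos by (intro mult_left_mono) auto
  then show "x mod g + g * i < l" using b l_eq by (simp add: algebra_simps)
qed

text \<open>If the classes of \<open>a\<close> and \<open>c - a\<close> are full, every element \<open>x\<close> of the first takes part in a representation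
  of every \<open>c'\<close> in the class of \<open>c\<close>. A \<open>c'\<close> in the middle of the period then has representations with
  both carries. At most one \<open>x\<close> modulo \<open>l\<close> has to be discarded because of \<open>2 * x = c'\<close>, so two
  candidates on each side are enough, which is possible for \<open>n \<ge> 5\<close>.\<close>

lemma no_full_class_pair:
  assumes "n \<ge> 5" "a \<in> T" "c - a \<in> T" "c \<notin> T"
    and nh: "\<not> [a = h] (mod g)" "\<not> [c - a = h] (mod g)" "\<not> [c = h] (mod g)"
  shows False
proof -
  \<comment> \<open>The elements \<open>x 0\<close> and \<open>x 1\<close> of the class of \<open>a\<close> are below \<open>c'\<close>, the elements \<open>x 3\<close> and \<open>x 4\<close> above.\<close>
  define c' where "c' = c mod g + g * 2"
  define x where "x i = a mod g + g * i" for i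
  have c'c: "[c = c'] (mod g)" and xa: "[a = x i] (mod g)" for i
    using class_residue by (simp_all add: c'_def x_def cong_sym)
  have c'T: "c' \<notin> T" using mem_cong_g[OF nh(3) c'c] assms by simp
  have xT: "x i \<in> T" for i using mem_cong_g[OF nh(1) xa] assms by simp
  have cxT: "c' - x i \<in> T" for i
    using mem_cong_g[OF nh(2) cong_diff[OF c'c xa]] assms by simp
  have modx: "x i mod l = x i" if "0 \<le> i" "i < n" for i
    using class_residue_range[OF that, of a] by (simp add: x_def)
  have modc: "c' mod l = c'"
    using class_residue_range[of 2 c] \<open>n \<ge> 5\<close> by (simp add: c'_def)
  obtain i where i: "i = 0 \<or> i = 1" "\<not> [2 * x i = c'] (mod l)"
    using not_cong_double[OF small_mult_not_cong[of 0 1 "a mod g"], of c'] \<open>n \<ge> 5\<close>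
    unfolding x_def by fastforce
  obtain j where j: "j = 3 \<or> j = 4" "\<not> [2 * x j = c'] (mod l)"
    using not_cong_double[OF small_mult_not_cong[of 3 4 "a mod g"], of c'] \<open>n \<ge> 5\<close>
    unfolding x_def by fastforce
  have "x i mod l < c' mod l \<longleftrightarrow> x j mod l < c' mod l"
    using one_sidedD[OF sided c'T xT cxT i(2) xT cxT j(2)] .
  moreover have "x i mod l = x i" "x j mod l = x j" using i(1) j(1) \<open>n \<ge> 5\<close> by (auto intro!: modx)
  moreover note modc
  moreover have "x i < c'" "\<not> x j < c'"
  proof -
  have "0 \<le> a mod g" "a mod g < g" "0 \<le> c mod g" "c mod g < g"
    using g_pos by simp_all
  moreover have "x i \<le> a mod g + g" "a mod g + g * 3 \<le> x j"
    using i(1) j(1) g_pos by (auto simp: x_def)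
  ultimately show "x i < c'" "\<not> x j < c'" unfolding c'_def by linarith+
  qed
  ultimately show False by simp
qed

text \<open>For two different full classes no representation has equal summands, so one candidate on each side
  suffices and \<open>n \<ge> 3\<close> is enough.\<close>

lemma no_mixed_class_pair:
  assumes "a \<in> T" "c - a \<in> T" "c \<notin> T" "\<not> [2 * a = c] (mod g)"
    and nh: "\<not> [a = h] (mod g)" "\<not> [c - a = h] (mod g)" "\<not> [c = h] (mod g)"
  shows False
proof -
  define c' where "c' = c mod g + g * 1"
  define x where "x i = a mod g + g * i" for i
  have c'c: "[c = c'] (mod g)" and xa: "[a = x i] (mod g)" for i
    using class_residue[of c 1] class_residue by (simp_all add: c'_def x_def cong_sym)
  have c'T: "c' \<notin> T" using mem_cong_g[OF nh(3) c'c] assms by simp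
  have xT: "x i \<in> T" for i using mem_cong_g[OF nh(1) xa] assms by simp
  have cxT: "c' - x i \<in> T" for i
    using mem_cong_g[OF nh(2) cong_diff[OF c'c xa]] assms by simp
  have nd: "\<not> [2 * x i = c'] (mod l)" for i
  proof
    assume "[2 * x i = c'] (mod l)"
    then have "[2 * x i = c'] (mod g)" by (rule cong_g_if_cong_l)
    then have "[2 * a = c] (mod g)"
      using cong_mult[OF cong_refl[of 2] xa[of i]] c'c by (metis cong_sym cong_trans)
    then show False using assms by simp
  qed
  have "x 0 mod l < c' mod l \<longleftrightarrow> x 2 mod l < c' mod l"
    using one_sidedD[OF sided c'T xT cxT nd xT cxT nd] .
  moreover have "x 0 mod l = x 0" "x 2 mod l = x 2" "c' mod l = c'"
    using class_residue_range[of 0 a] class_residue_range[of 2 a] class_residue_range[of 1 c] n_ge_3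
    by (simp_all add: x_def c'_def)
  moreover have "0 \<le> a mod g" "a mod g < g" "0 \<le> c mod g" "c mod g < g"
    using g_pos by simp_all
  then have "x 0 < c'" "\<not> x 2 < c'" unfolding x_def c'_def by linarith+
  ultimately show False by simp
qed

text \<open>If \<open>0\<close> lies in the class of \<open>h\<close>, it is not one of the two ends \<open>h\<close> and \<open>h + e\<close> of the progression, since
  the doubles of these are outside \<open>T\<close>.\<close>

lemma zero_position:
  assumes "[h = 0] (mod g)"
  obtains u where "1 \<le> u" "2 * u + 3 \<le> n" "[h + (2 * u + 1) * e = 0] (mod l)"
proof -
  from assms obtain t where t: "1 \<le> t" "t \<le> n" "[0 = h + t * e] (mod l)"
    using dvd_g_shift cong_sym by blast
  have "h + t * e \<in> T" using zero t(3) periodicD[OF per] by blast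
  then have odd: "odd t" using even_shift_not_mem[of t] t odd_n by (cases "t = n") auto
  have zero_double: "[2 * z = 0] (mod l)" if "[0 = z] (mod l)" for z
    using cong_mult[OF cong_refl[of 2] that] by (simp add: cong_sym)
  have "t \<noteq> 1"
    using zero_double[OF t(3)] end2 zero periodicD[OF per] by auto
  moreover have "t \<noteq> n"
  proof
    assume "t = n"
    then have "[0 = h] (mod l)" using t(3) cong_shift_iff[of n 0] cong_trans by auto
    then show False using zero_double[of h] end1 zero periodicD[OF per] by auto
  qed
  ultimately have "3 \<le> t" "t + 2 \<le> n" using t odd odd_n by presburger+
  moreover obtain u where "t = 2 * u + 1" using odd by (rule oddE)
  ultimately show ?thesis using that[of u] t(3) by (simp add: cong_sym)
qed

text \<open>Otherwise \<open>n \<ge> 5\<close> by \<open>zero_position\<close>, and a missing \<open>c\<close> that is not divisible by \<open>g\<close> is a sum of two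
  elements of \<open>T\<close>, neither of which is divisible by \<open>g\<close>. Their classes are full.\<close>

lemma partial_class_nonzero:
  assumes "g > 1"
  shows "\<not> [h = 0] (mod g)"
proof
  assume h0: "[h = 0] (mod g)"
  have "n \<ge> 5" using zero_position[OF h0] by force
  have one: "\<not> [1 = 0] (mod g)" "\<not> [2 * h - 1 = 0] (mod g)"
  proof -
    show "\<not> [1 = 0] (mod g)" using assms by (simp add: cong_def)
    show "\<not> [2 * h - 1 = 0] (mod g)"
    proof
      assume "[2 * h - 1 = 0] (mod g)"
      then have "g dvd 2 * h - 1" "g dvd h" using h0 by (simp_all add: cong_iff_dvd_diff)
      then have "g dvd 2 * h - (2 * h - 1)" using dvd_diff[OF dvd_mult] by blast
      then have "g dvd 1" by simp
      then show False using assms by simp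
    qed
  qed
  have "\<not> [1 = h] (mod l)" using one h0 cong_g_if_cong_l by (metis cong_trans)
  then have "1 \<in> T \<longleftrightarrow> 2 * h - 1 \<notin> T" using cen1 by (simp add: centre_def)
  then obtain c where c: "c \<notin> T" "\<not> [c = 0] (mod g)" using one by blast
  have ch: "\<not> [c = h] (mod g)" using c h0 cong_trans by blast
  have even0: "[2 * h = 0] (mod g)" "[2 * (h + e) = 0] (mod g)"
    using h0 g_dvd_e by (simp_all add: cong_iff_dvd_diff)
  have "\<not> [c = 2 * h] (mod l)" "\<not> [c = 2 * (h + e)] (mod l)"
    using c even0 cong_g_if_cong_l by (blast intro: cong_trans)+
  then obtain a where a: "a \<in> T" "c - a \<in> T" by (rule represented)
  have "\<not> [a = h] (mod g)"
  proof
    assume "[a = h] (mod g)"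
    then have "[a = 0] (mod g)" using h0 cong_trans by blast
    then have "[c = c - a] (mod g)" by (simp add: cong_iff_dvd_diff)
    then show False using mem_cong_g[OF ch] a c by blast
  qed
  moreover have "\<not> [c - a = h] (mod g)"
  proof
    assume "[c - a = h] (mod g)"
    then have "[c - a = 0] (mod g)" using h0 cong_trans by blast
    then have "[c = a] (mod g)" by (simp add: cong_iff_dvd_diff)
    then show False using mem_cong_g[OF ch] a c by blast
  qed
  ultimately show False using no_full_class_pair[OF \<open>n \<ge> 5\<close> a c(1)] ch by blast
qed

end

locale extremal_cosets = extremal +
  assumes g_gt_1: "g > 1"
begin

lemma h_nonzero: "\<not> [h = 0] (mod g)" using partial_class_nonzero[OF g_gt_1] .

lemma zero_class: "g dvd x \<Longrightarrow> x \<in> T"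
  using mem_cong_g[of 0 x] h_nonzero zero cong_sym[of 0 h g] cong_sym[of x 0 g]
  by (auto simp: cong_0_iff)

text \<open>For \<open>b\<close> and \<open>c\<close> in the class of \<open>h\<close>, the difference \<open>c - b\<close> is in the full class of \<open>0\<close>. So every element of the
  partial class represents every missing \<open>c\<close> of that class.\<close>

lemma partial_class_convex:
  assumes "c \<notin> T" "[c = h] (mod g)" "b \<in> T" "[b = h] (mod g)" "b' \<in> T" "[b' = h] (mod g)"
  shows "b mod l < c mod l \<longleftrightarrow> b' mod l < c mod l"
proof (rule one_sidedD[OF sided])
  have diff: "c - x \<in> T \<and> \<not> [2 * x = c] (mod l)" if "[x = h] (mod g)" for x
  proof -
    have cx: "[c - x = h - h] (mod g)" using assms(2) that by (rule cong_diff)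
    then have "c - x \<in> T" by (simp add: zero_class cong_0_iff)
    moreover have "\<not> [2 * x = c] (mod l)"
    proof
      assume "[2 * x = c] (mod l)"
      then have "[2 * x - x = c - x] (mod g)" by (intro cong_diff[OF _ cong_refl] cong_g_if_cong_l)
      then have "[x = c - x] (mod g)" by simp
      then have "[x = h - h] (mod g)" using cx by (rule cong_trans)
      then have "[x = 0] (mod g)" by simp
      then show False using h_nonzero that cong_sym cong_trans by blast
    qed
    ultimately show ?thesis by blast
  qed
  show "c - b \<in> T" "\<not> [2 * b = c] (mod l)" "c - b' \<in> T" "\<not> [2 * b' = c] (mod l)"
    using diff assms by blast+
qed (use assms in auto)

lemma two_of_partial_class:
  obtains b b' where "b \<in> T" "[b = h] (mod g)" "b' \<in> T" "[b' = h] (mod g)"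
    "0 \<le> b" "b + g \<le> b'" "b' < l"
proof -
  define x y where "x = h mod l" and "y = (h + e) mod l"
  have "\<not> [h = h + e] (mod l)" using distinct by (simp add: cong_iff_dvd_diff)
  then have "x \<noteq> y" by (simp add: x_def y_def cong_def)
  have T: "x \<in> T" "y \<in> T" using cen1 cen2 per by (simp_all add: x_def y_def periodic_mod centre_def)
  have "[x = h] (mod l)" "[y = h + e] (mod l)" by (simp_all add: x_def y_def cong_def)
  then have "[x = h] (mod g)" "[y = h + e] (mod g)" by (simp_all add: cong_g_if_cong_l)
  moreover have "[h + e = h] (mod g)" using g_dvd_e by (simp add: cong_iff_dvd_diff)
  ultimately have cong: "[x = h] (mod g)" "[y = h] (mod g)" by (blast intro: cong_trans)+
  have range: "0 \<le> x" "x < l" "0 \<le> y" "y < l" using l_pos by (simp_all add: x_def y_def)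
  have gap: "p + g \<le> q" if "[p = h] (mod g)" "[q = h] (mod g)" "p < q" for p q
  proof -
    have "[q = p] (mod g)" using that by (metis cong_sym cong_trans)
    then have "g \<le> q - p" using that by (intro zdvd_imp_le) (simp_all add: cong_iff_dvd_diff)
    then show ?thesis by simp
  qed
  show ?thesis
  proof (cases "x < y")
    case True
    then show ?thesis using that[of x y] T cong range gap by blast
  next
    case False
    then show ?thesis using that[of y x] T cong range gap \<open>x \<noteq> y\<close> by simp
  qed
qed

text \<open>Otherwise every element of the partial class represents every \<open>c'\<close> in the class of \<open>c\<close>, and some such
  \<open>c'\<close> lies between two elements of the partial class.\<close>

lemma translate_not_mem:
  assumes c: "c \<notin> T" "\<not> [c = h] (mod g)" "\<not> [c = 2 * h] (mod g)"
  shows "c - h \<notin> T"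
proof
  assume ch: "c - h \<in> T"
  have ch': "\<not> [c - h = h] (mod g)" using c(3) by (simp add: cong_iff_dvd_diff)
  obtain b b' where b: "b \<in> T" "[b = h] (mod g)" "b' \<in> T" "[b' = h] (mod g)"
    "0 \<le> b" "b + g \<le> b'" "b' < l" by (rule two_of_partial_class)
  define c' where "c' = b + (c - h) mod g"
  have "(c - h) mod g \<noteq> 0" using c(2) by (simp add: cong_iff_dvd_diff dvd_eq_mod_eq_0)
  moreover have "0 \<le> (c - h) mod g" "(c - h) mod g < g" using g_pos by auto
  ultimately have between: "b < c'" "c' < b'" using b by (auto simp: c'_def)
  have "[c' = h + (c - h)] (mod g)" unfolding c'_def
    by (intro cong_add b) (simp add: cong_def)
  then have c'c: "[c = c'] (mod g)" by (simp add: cong_sym)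
  have c'T: "c' \<notin> T" using mem_cong_g[OF c(2) c'c] c by blast
  have diff: "c' - x \<in> T \<and> \<not> [2 * x = c'] (mod l)" if "[x = h] (mod g)" for x
  proof -
    have "[c - h = c' - x] (mod g)" using c'c cong_sym[OF that] by (rule cong_diff)
    then have "c' - x \<in> T" using mem_cong_g[OF ch'] ch by blast
    moreover have "\<not> [2 * x = c'] (mod l)"
    proof
      assume "[2 * x = c'] (mod l)"
      then have "[2 * x = c'] (mod g)" by (rule cong_g_if_cong_l)
      moreover have "[2 * x = 2 * h] (mod g)" using cong_mult[OF cong_refl that] .
      ultimately show False using c(3) c'c by (metis cong_sym cong_trans)
    qed
    ultimately show ?thesis by blast
  qed
  have "b mod l < c' mod l \<longleftrightarrow> b' mod l < c' mod l"
    using one_sidedD[OF sided c'T b(1) _ _ b(3)] diff b by blast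
  then show False using between b by simp
qed

text \<open>The union of the classes modulo \<open>g\<close> that meet \<open>T\<close>. It is again a set with centre \<open>h\<close>, now modulo \<open>g\<close>, which
  makes the results on centres available one level down.\<close>

definition B where "B = T \<union> {x. [x = h] (mod g)}"

lemma B_off: "\<not> [x = h] (mod g) \<Longrightarrow> x \<in> B \<longleftrightarrow> x \<in> T"
  by (simp add: B_def)

lemma B_periodic: "periodic g B"
  unfolding periodic_def
proof (intro allI impI)
  fix x y assume xy: "[x = y] (mod g)"
  show "x \<in> B \<longleftrightarrow> y \<in> B"
  proof (cases "[x = h] (mod g)")
    case True
    then have "[y = h] (mod g)" using cong_trans[OF cong_sym[OF xy]] by blast
    then show ?thesis using True by (simp add: B_def)
  next
    case False
    then have "\<not> [y = h] (mod g)" using xy cong_trans by blast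
    then show ?thesis using False mem_cong_g[OF False xy] by (simp add: B_off)
  qed
qed

lemma reflect_not_h: "\<not> [x = h] (mod g) \<Longrightarrow> \<not> [2 * h - x = h] (mod g)"
  using cong_diff_cancel_left[of "2 * h" x h g] by simp

lemma B_centre: "centre g B h"
  unfolding centre_def
proof (intro conjI allI impI)
  fix x assume x: "\<not> [x = h] (mod g)"
  then have "\<not> [x = h] (mod l)" using cong_g_if_cong_l by blast
  then show "x \<in> B \<longleftrightarrow> 2 * h - x \<notin> B"
    using cen1 B_off[OF x] B_off[OF reflect_not_h[OF x]] by (simp add: centre_def)
qed (simp add: B_def)

lemma B_card: "2 * int (card (B \<inter> {0..<g})) = g + 1"
  by (rule card_centre[OF odd_g g_pos B_periodic B_centre])

text \<open>The partial class does not take part in a representation of \<open>c\<close>, and two full classes that do must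
  coincide.\<close>

lemma B_sum_equal:
  assumes c: "c \<notin> B" "\<not> [c = 2 * h] (mod g)" and ab: "a \<in> B" "b \<in> B" "[a + b = c] (mod g)"
  shows "a \<in> T" "b \<in> T" "\<not> [a = h] (mod g)" "\<not> [b = h] (mod g)" "[a = b] (mod g)"
proof -
  have ch: "\<not> [c = h] (mod g)" and cT: "c \<notin> T" using c(1) by (auto simp: B_def)
  have not_h: "\<not> [x = h] (mod g)" if xy: "y \<in> B" "[x + y = c] (mod g)" for x y
  proof
    assume x: "[x = h] (mod g)"
    have "[x + y - x = c - h] (mod g)" using xy(2) x by (rule cong_diff)
    then have y: "[y = c - h] (mod g)" by simp
    have "\<not> [c - h = h] (mod g)" using c(2) by (simp add: cong_iff_dvd_diff)
    then have "c - h \<in> T" using y xy(1) periodicD[OF B_periodic] B_off by blast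
    then show False using translate_not_mem[OF cT ch c(2)] by blast
  qed
  show a: "\<not> [a = h] (mod g)" using not_h ab by blast
  show b: "\<not> [b = h] (mod g)" using not_h[of a b] ab by (simp add: add.commute)
  show T: "a \<in> T" "b \<in> T" using a b ab B_off by auto
  have "\<not> [a + b = h] (mod g)" using ab(3) ch by (metis cong_sym cong_trans)
  moreover have "a + b \<notin> T" using mem_cong_g[OF ch cong_sym[OF ab(3)]] cT by blast
  ultimately have "[2 * a = a + b] (mod g)"
    using no_mixed_class_pair[of a "a + b"] T a b by auto
  then show "[a = b] (mod g)" by (simp only: mult_2 cong_add_lcancel)
qed

text \<open>Modulo \<open>g\<close>, the class of \<open>c\<close> is unrepresented by different classes and hence gives a centre of \<open>B\<close>. Modulo
  \<open>l\<close> it is represented, by elements of full classes, which limits \<open>n\<close>.\<close>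

lemma missing_class:
  assumes c: "c \<notin> B" "\<not> [c = 2 * h] (mod g)"
  shows "n = 3" "\<exists>h'. [2 * h' = c] (mod g) \<and> centre g B h'"
proof -
  have "unrepresented g B c"
    unfolding unrepresented_def
  proof (intro ballI impI)
    fix a assume "a \<in> B" "c - a \<in> B"
    then have "[a = c - a] (mod g)" using B_sum_equal(5)[OF c, of a "c - a"] by simp
    then have "[a + a = c - a + a] (mod g)" by (rule cong_add) simp
    then show "[2 * a = c] (mod g)" by simp
  qed
  then show "\<exists>h'. [2 * h' = c] (mod g) \<and> centre g B h'"
    using unrepresented_imp_centre[OF odd_g g_pos B_periodic B_card] by blast
  have "[2 * (h + e) = 2 * h] (mod g)" using g_dvd_e by (simp add: cong_iff_dvd_diff)
  then have "\<not> [c = 2 * h] (mod l)" "\<not> [c = 2 * (h + e)] (mod l)"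
    using c(2) cong_g_if_cong_l by (blast intro: cong_trans)+
  then obtain a where a: "a \<in> T" "c - a \<in> T" by (rule represented)
  have B: "a \<in> B" "c - a \<in> B" using a by (auto simp: B_def)
  have "\<not> [a = h] (mod g)" "\<not> [c - a = h] (mod g)" using B_sum_equal(3,4)[OF c B] by auto
  moreover have "c \<notin> T" "\<not> [c = h] (mod g)" using c by (auto simp: B_def)
  ultimately have "\<not> n \<ge> 5" using no_full_class_pair a by blast
  then show "n = 3" using n_ge_3 odd_n by presburger
qed

lemma obtain_missing_class:
  assumes "2 * int (card F) < g - 1" "finite F"
  obtains c where "c \<notin> B" "\<And>f. f \<in> F \<Longrightarrow> \<not> [c = f] (mod g)"
proof -
  define F' where "F' = (\<lambda>f. f mod g) ` F"
  have "card (B \<inter> {0..<g} \<union> F') \<le> card (B \<inter> {0..<g}) + card F'" by (rule card_Un_le)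
  moreover have "card F' \<le> card F" unfolding F'_def using assms by (intro card_image_le)
  moreover have "card {0..<g} = nat g" by simp
  ultimately have "card (B \<inter> {0..<g} \<union> F') < card {0..<g}"
    using B_card assms(1) g_pos by linarith
  then have "\<not> {0..<g} \<subseteq> B \<inter> {0..<g} \<union> F'"
    using card_mono[of "B \<inter> {0..<g} \<union> F'" "{0..<g}"] assms by (auto simp: F'_def)
  then obtain c where c: "c \<in> {0..<g}" "c \<notin> B" "c \<notin> F'" by blast
  have "\<not> [c = f] (mod g)" if "f \<in> F" for f
    using that c by (auto simp: F'_def cong_def)
  then show ?thesis using that c by blast
qed

text \<open>Of the \<open>(g - 1) div 2\<close> classes outside \<open>B\<close>, all except possibly that of \<open>2 * h\<close> give centres of \<open>B\<close>
  different from \<open>h\<close>; there is at most one of these, and if there is one, then \<open>n = 3\<close>.\<close>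

lemma g_cases: "g = 3 \<or> (g = 5 \<and> n = 3)"
proof -
  have "g \<le> 5"
  proof (rule ccontr)
    assume "\<not> g \<le> 5"
    then have g: "g \<ge> 7" using odd_g by presburger
    obtain c where c: "c \<notin> B" "\<not> [c = 2 * h] (mod g)"
      using obtain_missing_class[of "{2 * h}"] g by auto
    have "2 * int (card {2 * h, c}) < g - 1" using g by (simp add: card_insert_if)
    then obtain c' where "c' \<notin> B" "\<And>f. f \<in> {2 * h, c} \<Longrightarrow> \<not> [c' = f] (mod g)"
      by (rule obtain_missing_class) auto
    then have c': "c' \<notin> B" "\<not> [c' = 2 * h] (mod g)" "\<not> [c' = c] (mod g)" by auto
    obtain h1 h2 where h1: "[2 * h1 = c] (mod g)" "centre g B h1"
      and h2: "[2 * h2 = c'] (mod g)" "centre g B h2"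
      using missing_class(2)[OF c] missing_class(2)[OF c'(1,2)] by blast
    have "\<not> g dvd h1 - h"
    proof
      assume "g dvd h1 - h"
      then have "[h1 = h] (mod g)" by (simp add: cong_iff_dvd_diff)
      then have "[2 * h1 = 2 * h] (mod g)" by (simp only: cong_double_cancel[OF odd_g])
      then show False using c h1 by (metis cong_sym cong_trans)
    qed
    then have "two_centres g B h (h1 - h)"
      using odd_g g_pos B_periodic B_centre h1 by (simp add: two_centres_def)
    then have "[h2 = h] (mod g) \<or> [h2 = h + (h1 - h)] (mod g)"
      using h2(2) by (rule two_centres.at_most_two_centres)
    then have "[h2 = h] (mod g) \<or> [h2 = h1] (mod g)" by simp
    then have "[2 * h2 = 2 * h] (mod g) \<or> [2 * h2 = 2 * h1] (mod g)"
      by (simp only: cong_double_cancel[OF odd_g])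
    then show False using c' h1 h2 by (metis cong_sym cong_trans)
  qed
  moreover have "n = 3" if five: "g = 5"
  proof -
    obtain c where "c \<notin> B" "\<not> [c = 2 * h] (mod g)"
      using obtain_missing_class[of "{2 * h}"] five by auto
    then show ?thesis by (rule missing_class(1))
  qed
  ultimately show ?thesis using g_gt_1 odd_g by presburger
qed

text \<open>By convexity the elements of the partial class in \<open>{0..<l}\<close> form a progression with difference \<open>g\<close>. Its
  length comes from the other description of the same elements, as \<open>h + t * e\<close> with odd \<open>t\<close>.\<close>

lemma partial_class_interval:
  obtains \<theta> where "0 \<le> \<theta>" "[\<theta> = h] (mod g)" "\<theta> + g * ((n - 1) div 2) < l"
    "\<And>x. \<lbrakk>0 \<le> x; x < l; [x = h] (mod g)\<rbrakk> \<Longrightarrow> x \<in> T \<longleftrightarrow> \<theta> \<le> x \<and> x \<le> \<theta> + g * ((n - 1) div 2)"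
proof -
  define m where "m = (n - 1) div 2"
  have m: "n = 2 * m + 1" "m \<ge> 0" using odd_n n_pos by (auto simp: m_def elim!: oddE)
  define P where "P = {x \<in> T. 0 \<le> x \<and> x < l \<and> [x = h] (mod g)}"
  have "finite P" by (rule finite_subset[of _ "{0..<l}"]) (auto simp: P_def)
  define f where "f j = (h + (2 * j + 1) * e) mod l" for j
  \<comment> \<open>Counting: \<open>P\<close> has \<open>m + 1\<close> elements because \<open>t = 2 * j + 1\<close> runs through the odd numbers up to \<open>n\<close>.\<close>
  have "P = f ` {0..m}"
  proof (intro equalityI subsetI)
    fix x assume "x \<in> P"
    then have x: "x \<in> T" "0 \<le> x" "x < l" "[x = h] (mod g)" by (auto simp: P_def)
    then obtain t where t: "1 \<le> t" "t \<le> n" "[x = h + t * e] (mod l)" by (blast elim: dvd_g_shift)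
    have "h + t * e \<in> T" using x(1) t(3) periodicD[OF per] by blast
    then have "odd t" using even_shift_not_mem[of t] t odd_n by (cases "t = n") auto
    then obtain j where "t = 2 * j + 1" by (rule oddE)
    moreover have "x = (h + t * e) mod l" using t(3) x by (simp add: cong_def)
    ultimately show "x \<in> f ` {0..m}" using t m by (auto simp: f_def)
  next
    fix x assume "x \<in> f ` {0..m}"
    then obtain j where j: "0 \<le> j" "j \<le> m" "x = f j" by auto
    have "h + (2 * j + 1) * e \<in> T" using j m by (intro odd_shift_mem) auto
    then have "x \<in> T" using j per by (simp add: f_def periodic_mod)
    have "[x = h + (2 * j + 1) * e] (mod g)"
      using j by (intro cong_g_if_cong_l) (simp add: f_def cong_def)
    moreover have "[h + (2 * j + 1) * e = h] (mod g)" using g_dvd_e by (simp add: cong_iff_dvd_diff)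
    ultimately have "[x = h] (mod g)" by (rule cong_trans)
    with \<open>x \<in> T\<close> show "x \<in> P" using j l_pos by (simp add: P_def f_def)
  qed
  moreover have "inj_on f {0..m}"
  proof (rule inj_onI)
    fix i j assume ij: "i \<in> {0..m}" "j \<in> {0..m}" "f i = f j"
    then have "n dvd (2 * i + 1) - (2 * j + 1)" using cong_shift_iff by (simp add: f_def cong_def)
    then have "[2 * i + 1 = 2 * j + 1] (mod n)" by (simp add: cong_iff_dvd_diff)
    then have "2 * i + 1 = 2 * j + 1" using ij m by (intro cong_int_bound) auto
    then show "i = j" by simp
  qed
  ultimately have cardP: "card P = nat (m + 1)" by (simp add: card_image)
  then have "P \<noteq> {}" using m by auto
  define \<theta> where "\<theta> = Min P"
  define M where "M = Max P"
  have \<theta>: "\<theta> \<in> P" and M: "M \<in> P" using \<open>finite P\<close> \<open>P \<noteq> {}\<close> by (simp_all add: \<theta>_def M_def)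
  have bounds: "\<theta> \<le> x" "x \<le> M" if "x \<in> P" for x
    using that \<open>finite P\<close> by (simp_all add: \<theta>_def M_def)
  have between: "x \<in> P" if "\<theta> \<le> x" "x \<le> M" "[x = h] (mod g)" for x
  proof (rule ccontr)
    assume "x \<notin> P"
    then have "x \<notin> T" "x \<noteq> \<theta>" "x \<noteq> M" using that \<theta> M by (auto simp: P_def)
    moreover have "\<theta> mod l = \<theta>" "M mod l = M" "x mod l = x" using \<theta> M that by (auto simp: P_def)
    ultimately show False
      using partial_class_convex[of x \<theta> M] that \<theta> M by (auto simp: P_def)
  qed
  have "[M = \<theta>] (mod g)" using M \<theta> unfolding P_def by (blast intro: cong_trans cong_sym)
  then obtain s where s: "M - \<theta> = g * s" by (auto simp: cong_iff_dvd_diff)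
  have "s \<ge> 0" using s bounds[OF M] bounds[OF \<theta>] g_pos
    by (metis diff_ge_0_iff_ge zero_le_mult_iff not_less)
  have \<theta>h: "[\<theta> = h] (mod g)" using \<theta> by (simp add: P_def)
  have "P = (\<lambda>i. \<theta> + g * i) ` {0..s}"
  proof (intro equalityI subsetI)
    fix x assume x: "x \<in> P"
    then have "[x = \<theta>] (mod g)" using \<theta>h unfolding P_def by (blast intro: cong_trans cong_sym)
    then obtain i where i: "x - \<theta> = g * i" by (auto simp: cong_iff_dvd_diff)
    have "0 \<le> g * i" "g * i \<le> g * s" using bounds[OF x] i s by linarith+
    then have "0 \<le> i" "i \<le> s" using g_pos by (auto simp: zero_le_mult_iff)
    then show "x \<in> (\<lambda>i. \<theta> + g * i) ` {0..s}" using i by (auto intro!: image_eqI[of _ _ i])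
  next
    fix x assume "x \<in> (\<lambda>i. \<theta> + g * i) ` {0..s}"
    then obtain i where i: "0 \<le> i" "i \<le> s" "x = \<theta> + g * i" by auto
    have "0 \<le> g * i" "g * i \<le> g * s" using i g_pos by auto
    moreover have "[x = \<theta>] (mod g)" using i by (simp add: cong_iff_dvd_diff)
    then have "[x = h] (mod g)" using \<theta>h cong_trans by blast
    ultimately show "x \<in> P" using i s by (intro between) linarith+
  qed
  moreover have "inj_on (\<lambda>i. \<theta> + g * i) {0..s}" using g_pos by (auto intro!: inj_onI)
  ultimately have "card P = nat (s + 1)" by (simp add: card_image)
  then have "s = m" using cardP m \<open>s \<ge> 0\<close> by simp
  then have M_eq: "M = \<theta> + g * m" using s by simp
  show ?thesis
  proof (rule that[of \<theta>], fold m_def M_eq)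
    show "x \<in> T \<longleftrightarrow> \<theta> \<le> x \<and> x \<le> M" if "0 \<le> x" "x < l" "[x = h] (mod g)" for x
      using bounds[of x] between[of x] that by (auto simp: P_def)
  qed (use \<theta> M \<theta>h in \<open>auto simp: P_def\<close>)
qed

end

context extremal_cosets
begin

text \<open>Modulo \<open>3\<close> the three classes are those of \<open>0\<close>, which is full, of \<open>h\<close>, which is partial, and of \<open>2 * h\<close>, which is
  the reflection of the first and hence empty.\<close>

lemma three_cosets:
  assumes "g = 3"
  obtains \<theta> where "1 \<le> \<theta>" "\<not> 3 dvd \<theta>" "l = 3 * n" "\<theta> + 3 * ((n - 1) div 2) < l"
    "\<And>x. \<lbrakk>0 \<le> x; x < l\<rbrakk> \<Longrightarrow>
      x \<in> T \<longleftrightarrow> 3 dvd x \<or> (\<theta> \<le> x \<and> x \<le> \<theta> + 3 * ((n - 1) div 2) \<and> [x = \<theta>] (mod 3))"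
proof -
  obtain \<theta> where \<theta>: "0 \<le> \<theta>" "[\<theta> = h] (mod 3)" "\<theta> + 3 * ((n - 1) div 2) < l"
    "\<And>x. \<lbrakk>0 \<le> x; x < l; [x = h] (mod 3)\<rbrakk> \<Longrightarrow> x \<in> T \<longleftrightarrow> \<theta> \<le> x \<and> x \<le> \<theta> + 3 * ((n - 1) div 2)"
    using partial_class_interval unfolding assms by metis
  have h3: "\<not> 3 dvd h" using h_nonzero assms by (simp add: cong_0_iff)
  have \<theta>3: "\<not> 3 dvd \<theta>" using \<theta>(2) h3 cong_dvd_iff by blast
  then have "\<theta> \<noteq> 0" by auto
  have "x \<in> T \<longleftrightarrow> 3 dvd x \<or> (\<theta> \<le> x \<and> x \<le> \<theta> + 3 * ((n - 1) div 2) \<and> [x = \<theta>] (mod 3))"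
    if x: "0 \<le> x" "x < l" for x
  proof -
    consider "3 dvd x" | "[x = h] (mod 3)" | "3 dvd 2 * h - x" "\<not> [x = h] (mod 3)" "\<not> 3 dvd x"
    proof -
      have "3 dvd x \<or> [x = h] (mod 3) \<or> 3 dvd 2 * h - x" unfolding cong_def using h3 by presburger
      then show ?thesis using that by blast
    qed
    then show ?thesis
    proof cases
      case 1
      then show ?thesis using zero_class assms by simp
    next
      case 2
      then have "\<not> 3 dvd x" using h3 cong_dvd_iff by blast
      moreover have "[x = \<theta>] (mod 3)" using 2 \<theta>(2) cong_sym cong_trans by blast
      ultimately show ?thesis using \<theta>(4)[OF x 2] by simp
    next
      case 3
      then have "\<not> [x = h] (mod l)" using cong_g_if_cong_l[unfolded assms] by blast
      moreover have "2 * h - x \<in> T" using 3 zero_class assms by simp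
      ultimately have "x \<notin> T" using cen1 unfolding centre_def by blast
      moreover have "\<not> [x = \<theta>] (mod 3)" using 3(2) \<theta>(2) cong_trans by blast
      ultimately show ?thesis using 3(3) by simp
    qed
  qed
  then show ?thesis using that[of \<theta>] \<theta> \<theta>3 \<open>\<theta> \<noteq> 0\<close> l_eq assms by simp
qed

text \<open>The classes are those of \<open>m * h\<close> with \<open>0 \<le> m \<le> 4\<close>, and the reflection exchanges \<open>m\<close> with \<open>2 - m\<close>.
  So \<open>0\<close> is full and \<open>2\<close> is empty, and of \<open>3\<close> and \<open>4\<close> one is full and one is empty. If \<open>4\<close> were empty,
  its translate by \<open>- h\<close>, which is \<open>3\<close>, would have to be empty as well. Here \<open>p\<close> is the residue of \<open>h\<close>.\<close>

lemma five_cosets: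
  assumes "g = 5" "n = 3"
  obtains p \<theta> where "l = 15" "1 \<le> p" "p \<le> 4" "\<theta> = p \<or> \<theta> = p + 5"
    "\<And>x. \<lbrakk>0 \<le> x; x < 15\<rbrakk> \<Longrightarrow> x \<in> T \<longleftrightarrow> 5 dvd x \<or> 5 dvd x + p \<or> x = \<theta> \<or> x = \<theta> + 5"
proof -
  have l: "l = 15" using l_eq assms by simp
  obtain \<theta> where \<theta>: "0 \<le> \<theta>" "[\<theta> = h] (mod 5)" "\<theta> + 5 < l"
    "\<And>x. \<lbrakk>0 \<le> x; x < l; [x = h] (mod 5)\<rbrakk> \<Longrightarrow> x \<in> T \<longleftrightarrow> \<theta> \<le> x \<and> x \<le> \<theta> + 5"
    using partial_class_interval unfolding assms by (simp; metis)
  define p where "p = h mod 5"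
  have hp: "[h = p] (mod 5)" by (simp add: p_def cong_def)
  have h5: "\<not> 5 dvd h" using h_nonzero assms by (simp add: cong_0_iff)
  then have p: "1 \<le> p" "p \<le> 4" unfolding p_def by presburger+
  have \<theta>_cases: "\<theta> = p \<or> \<theta> = p + 5"
  proof -
    have "\<theta> mod 5 = p" using \<theta>(2) by (simp add: p_def cong_def)
    then show ?thesis using \<theta>(1,3) l by presburger
  qed
  have off: "y \<in> T \<longleftrightarrow> 2 * h - y \<notin> T" if "\<not> [y = h] (mod 5)" for y
  proof -
    have "\<not> [y = h] (mod l)" using that cong_g_if_cong_l[unfolded assms] by blast
    then show ?thesis using cen1 unfolding centre_def by blast
  qed
  have periodic5: "x \<in> T \<longleftrightarrow> y \<in> T" if "\<not> [x = h] (mod 5)" "[x = y] (mod 5)" for x y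
    using mem_cong_g that assms by simp
  have neg: "- h \<in> T"
  proof (rule ccontr)
    assume "- h \<notin> T"
    moreover have "\<not> [- h = h] (mod 5)" "\<not> [- h = 2 * h] (mod 5)"
      using h5 unfolding cong_iff_dvd_diff by presburger+
    ultimately have "2 * h - (- h) \<in> T" "- h - h \<notin> T"
      using off[of "- h"] translate_not_mem[of "- h"] assms by auto
    moreover have "[2 * h - (- h) = - h - h] (mod 5)" "\<not> [2 * h - (- h) = h] (mod 5)"
      using h5 unfolding cong_iff_dvd_diff by presburger+
    ultimately show False using periodic5 by blast
  qed
  have "x \<in> T \<longleftrightarrow> 5 dvd x \<or> 5 dvd x + p \<or> x = \<theta> \<or> x = \<theta> + 5" if x: "0 \<le> x" "x < 15" for x
  proof (cases "[x = h] (mod 5)")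
    case True
    have "\<not> 5 dvd x" using True h5 cong_dvd_iff by blast
    moreover have "\<not> 5 dvd x + p"
    proof -
      have "[x + p = h + h] (mod 5)" using True cong_sym[OF hp] by (rule cong_add)
      moreover have "\<not> 5 dvd h + h" using h5 by presburger
      ultimately show ?thesis using cong_dvd_iff by blast
    qed
    moreover have "x \<in> T \<longleftrightarrow> \<theta> \<le> x \<and> x \<le> \<theta> + 5" using \<theta>(4) True x l by simp
    moreover have "\<theta> \<le> x \<and> x \<le> \<theta> + 5 \<longleftrightarrow> x = \<theta> \<or> x = \<theta> + 5"
      using True \<theta>(2) unfolding cong_iff_dvd_diff by presburger
    ultimately show ?thesis by blast
  next
    case False
    have "[\<theta> + 5 = h] (mod 5)" using \<theta>(2) by (simp add: cong_def)
    then have "x \<noteq> \<theta>" "x \<noteq> \<theta> + 5" using False \<theta>(2) by auto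
    moreover have "x \<in> T \<longleftrightarrow> 5 dvd x \<or> 5 dvd x + p"
    proof -
      \<comment> \<open>Express \<open>x\<close> as a multiple \<open>h * m\<close> modulo \<open>5\<close> and check the five values of \<open>m\<close>.\<close>
      have "prime (5 :: int)" by simp
      then have "coprime h 5" using h5 prime_imp_coprime coprime_commute by blast
      then obtain s where "[h * s = 1] (mod 5)" using cong_solve_coprime_int by blast
      then have "[h * s * x = 1 * x] (mod 5)" by (rule cong_scalar_right)
      moreover have "[h * (s * x mod 5) = h * (s * x)] (mod 5)"
        by (rule cong_scalar_left) (simp add: cong_def)
      moreover define m where "m = s * x mod 5"
      ultimately have xm: "[x = h * m] (mod 5)" unfolding mult.assoc mult_1
        using cong_sym cong_trans by blast
      have "0 \<le> m" "m < 5" by (simp_all add: m_def)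
      then consider "m = 0" | "m = 1" | "m = 2" | "m = 3" | "m = 4" by linarith
      then show ?thesis
      proof cases
        case 1
        then have "5 dvd x" using xm by (simp add: cong_0_iff)
        then show ?thesis using zero_class assms by simp
      next
        case 2
        then show ?thesis using False xm by simp
      next
        case 3
        then have "5 dvd 2 * h - x" using xm by (simp add: cong_iff_dvd_diff dvd_diff_commute mult.commute)
        then have "x \<notin> T" using off[OF False] zero_class assms by simp
        moreover have "[x + p = h * 2 + h] (mod 5)"
          using cong_add[OF xm cong_sym[OF hp]] 3 by simp
        then have "5 dvd x + p \<longleftrightarrow> 5 dvd h * 2 + h" by (rule cong_dvd_iff)
        moreover have "5 dvd x \<longleftrightarrow> 5 dvd h * 2" using cong_dvd_iff[OF xm] 3 by simp
        moreover have "\<not> 5 dvd h * 2" "\<not> 5 dvd h * 2 + h" using h5 by presburger+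
        ultimately show ?thesis by blast
      next
        case 4
        have "[2 * h - x = - h] (mod 5)"
          using cong_diff[OF cong_refl[of "2 * h"] xm] 4 by simp
        moreover have "\<not> [- h = h] (mod 5)" using h5 unfolding cong_iff_dvd_diff by presburger
        ultimately have "2 * h - x \<in> T" using periodic5[of "- h" "2 * h - x"] neg cong_sym by blast
        then have "x \<notin> T" using off[OF False] by blast
        moreover have "[x + p = h * 3 + h] (mod 5)"
          using cong_add[OF xm cong_sym[OF hp]] 4 by simp
        then have "5 dvd x + p \<longleftrightarrow> 5 dvd h * 3 + h" by (rule cong_dvd_iff)
        moreover have "5 dvd x \<longleftrightarrow> 5 dvd h * 3" using cong_dvd_iff[OF xm] 4 by simp
        moreover have "\<not> 5 dvd h * 3" "\<not> 5 dvd h * 3 + h" using h5 by presburger+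
        ultimately show ?thesis by blast
      next
        case 5
        have "[- h = h * 4] (mod 5)" by (simp add: cong_iff_dvd_diff)
        then have "[x = - h] (mod 5)" using xm 5 cong_sym cong_trans by blast
        then have "x \<in> T" using periodic5[OF False] neg by blast
        moreover have "[x + p = - h + h] (mod 5)"
          using \<open>[x = - h] (mod 5)\<close> cong_sym[OF hp] by (rule cong_add)
        then have "5 dvd x + p" by (simp add: cong_0_iff)
        ultimately show ?thesis by blast
      qed
    qed
    ultimately show ?thesis by blast
  qed
  then show ?thesis using that[of p \<theta>] l p \<theta>_cases by blast
qed

end

section \<open>Dilated intervals\<close>

text \<open>The residues of \<open>i * d\<close> with \<open>- u \<le> i \<le> v\<close>. The window \<open>- u \<le> i < l - u\<close> contains one representative \<open>i\<close> of
  every class, so membership is decided for all integers. The bounds \<open>1 \<le> u\<close> and \<open>1 \<le> v\<close> express that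
  \<open>0\<close> is not an end of the progression.\<close>

definition dilated_interval :: "int \<Rightarrow> int \<Rightarrow> int \<Rightarrow> int \<Rightarrow> int set \<Rightarrow> bool" where
  "dilated_interval l d u v T \<longleftrightarrow> coprime d l \<and> 1 \<le> u \<and> 1 \<le> v \<and> l = 2 * u + 2 * v + 1 \<and>
    (\<forall>i. - u \<le> i \<and> i < l - u \<longrightarrow> (i * d \<in> T \<longleftrightarrow> i \<le> v))"

text \<open>Here the class of \<open>h\<close> is everything, and \<open>T\<close> is the progression of the \<open>h + t * e\<close> with odd \<open>t\<close>. Its
  parameter is shifted so that it vanishes at the element \<open>0\<close>.\<close>

lemma (in extremal) dilated_interval_if_generator:
  assumes "g = 1"
  obtains u v where "dilated_interval l (2 * e) u v T"
proof -
  have nl: "n = l" using l_eq assms by simp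
  have "[h = 0] (mod g)" using assms by simp
  then obtain u where u: "1 \<le> u" "2 * u + 3 \<le> n" "[h + (2 * u + 1) * e = 0] (mod l)"
    by (rule zero_position)
  define v where "v = (l - 1) div 2 - u"
  have v: "l = 2 * u + 2 * v + 1" "1 \<le> v" using odd_l u nl by (auto simp: v_def elim!: oddE)
  have cop: "coprime (2 * e) l"
    using odd_l assms by (simp add: g_def coprime_iff_gcd_eq_1[of e])
  have "i * (2 * e) \<in> T \<longleftrightarrow> i \<le> v" if i: "- u \<le> i" "i < l - u" for i
  proof -
    define t where "t = 2 * (i + u) + 1"
    have "[i * (2 * e) + 0 = i * (2 * e) + (h + (2 * u + 1) * e)] (mod l)"
      using u(3) by (intro cong_add cong_refl) (rule cong_sym)
    then have t: "[i * (2 * e) = h + t * e] (mod l)" by (simp add: t_def algebra_simps)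
    show ?thesis
    proof (cases "i \<le> v")
      case True
      then have "h + t * e \<in> T" using i v nl by (intro odd_shift_mem) (auto simp: t_def)
      then show ?thesis using True t periodicD[OF per] by blast
    next
      case False
      have "[h + t * e = h + (t - l) * e] (mod l)" using nl by (simp add: cong_shift_iff)
      moreover have "h + (t - l) * e \<notin> T"
        using False i v nl odd_l by (intro even_shift_not_mem) (auto simp: t_def)
      ultimately show ?thesis using False t periodicD[OF per] by blast
    qed
  qed
  then show ?thesis using that[of u v] cop u(1) v by (simp add: dilated_interval_def)
qed

lemma dilated_interval_cong:
  assumes "periodic l T" "[d = d'] (mod l)" "dilated_interval l d u v T"
  shows "dilated_interval l d' u v T"
proof -
  have "coprime d' l" using assms(2,3) cong_imp_coprime by (auto simp: dilated_interval_def)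
  moreover have "i * d \<in> T \<longleftrightarrow> i * d' \<in> T" for i
    using periodicD[OF assms(1)] cong_scalar_left[OF assms(2)] by blast
  ultimately show ?thesis using assms(3) by (simp add: dilated_interval_def)
qed

lemma dilated_interval_flip:
  assumes "periodic l T" "dilated_interval l d u v T"
  shows "dilated_interval l (- d) v u T"
proof -
  have l: "l = 2 * u + 2 * v + 1" and mem: "\<And>i. \<lbrakk>- u \<le> i; i < l - u\<rbrakk> \<Longrightarrow> i * d \<in> T \<longleftrightarrow> i \<le> v"
    and "1 \<le> u" "1 \<le> v"
    using assms(2) by (auto simp: dilated_interval_def)
  have "i * (- d) \<in> T \<longleftrightarrow> i \<le> u" if i: "- v \<le> i" "i < l - v" for i
  proof (cases "i \<le> u")
    case True
    then show ?thesis using mem[of "- i"] i l \<open>1 \<le> u\<close> by simp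
  next
    case False
    have "[i * (- d) = (l - i) * d] (mod l)" by (simp add: cong_iff_dvd_diff algebra_simps)
    moreover have "(l - i) * d \<notin> T" using False mem[of "l - i"] i l by simp
    ultimately show ?thesis using False periodicD[OF assms(1)] by blast
  qed
  moreover have "coprime (- d) l" using assms(2) unfolding dilated_interval_def coprime_minus_left_iff by blast
  moreover have "l = 2 * v + 2 * u + 1" using l by simp
  ultimately show ?thesis using \<open>1 \<le> u\<close> \<open>1 \<le> v\<close> unfolding dilated_interval_def by blast
qed

lemma mod_add_residues:
  fixes a b l :: int
  assumes "0 \<le> a" "a < l" "0 \<le> b" "b < l"
  shows "(a + b) mod l = (if a + b < l then a + b else a + b - l)"
proof (cases "a + b < l")
  case False
  have "(a + b) mod l = (a + b - l) mod l" by simp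
  also have "\<dots> = a + b - l" using assms False by (intro mod_pos_pos_trivial) auto
  finally show ?thesis using False by simp
qed (use assms in simp)

text \<open>A sum \<open>i + j\<close> between \<open>v\<close> and \<open>2 * v\<close> is the parameter of a missing residue, whose representations all have the
  same carry.\<close>

lemma dilated_interval_sums:
  assumes per: "periodic l T" and sided: "one_sided l T" and dil: "dilated_interval l d u v T"
    and i: "1 \<le> i" "i \<le> v" "1 \<le> j" "j \<le> v" "i \<noteq> j"
    and i': "1 \<le> i'" "i' \<le> v" "1 \<le> j'" "j' \<le> v" "i' \<noteq> j'"
    and s: "i + j = i' + j'" "v < i + j"
  shows "(i * d) mod l + (j * d) mod l = (i' * d) mod l + (j' * d) mod l"
proof -
  have cop: "coprime d l" and l: "l = 2 * u + 2 * v + 1" and uv: "1 \<le> u" "1 \<le> v"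
    and mem: "\<And>i. \<lbrakk>- u \<le> i; i < l - u\<rbrakk> \<Longrightarrow> i * d \<in> T \<longleftrightarrow> i \<le> v"
    using dil by (auto simp: dilated_interval_def)
  define c where "c = (i + j) * d"
  have inj: "a = b" if "[a * d = b * d] (mod l)" "\<bar>a - b\<bar> < l" for a b
    using that cong_mult_rcancel[OF cop] cong_int_bound by blast
  have cT: "c \<notin> T" using mem[of "i + j"] i s l uv by (simp add: c_def)
  have pair: "x * d \<in> T \<and> c - x * d \<in> T \<and> \<not> [2 * (x * d) = c] (mod l) \<and>
      (x * d) mod l + (y * d) mod l = c mod l + (if (x * d) mod l < c mod l then 0 else l)"
    if x: "1 \<le> x" "x \<le> v" "1 \<le> y" "y \<le> v" "x \<noteq> y" "x + y = i + j" for x y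
  proof (intro conjI)
    have cxy: "c = x * d + y * d" using x by (simp add: c_def flip: distrib_right)
    have T: "x * d \<in> T" "y * d \<in> T" using mem[of x] mem[of y] x l uv by auto
    show "x * d \<in> T" by fact
    show "c - x * d \<in> T" using T cxy by simp
    show "\<not> [2 * (x * d) = c] (mod l)"
    proof
      assume "[2 * (x * d) = c] (mod l)"
      then have "[x * d = y * d] (mod l)" unfolding mult_2 cxy cong_add_lcancel .
      moreover have "\<bar>x - y\<bar> < l" using x l uv by linarith
      ultimately show False using inj x by blast
    qed
    have "\<bar>y - 0\<bar> < l" "y \<noteq> 0" using x l uv by linarith+
    then have "\<not> [y * d = 0 * d] (mod l)" using inj by blast
    then have "(y * d) mod l \<noteq> 0" by (simp add: cong_def)
    moreover have "0 \<le> (x * d) mod l" "(x * d) mod l < l" "0 \<le> (y * d) mod l" "(y * d) mod l < l"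
      using l uv pos_mod_sign[of l] pos_mod_bound[of l] by simp_all
    moreover have "c mod l = ((x * d) mod l + (y * d) mod l) mod l" by (simp add: cxy mod_add_eq)
    then have "c mod l = (if (x * d) mod l + (y * d) mod l < l
        then (x * d) mod l + (y * d) mod l else (x * d) mod l + (y * d) mod l - l)"
      using calculation by (simp only: mod_add_residues)
    ultimately show "(x * d) mod l + (y * d) mod l =
        c mod l + (if (x * d) mod l < c mod l then 0 else l)" by auto
  qed
  have "(i * d) mod l < c mod l \<longleftrightarrow> (i' * d) mod l < c mod l"
    using one_sidedD[OF sided cT, of "i * d" "i' * d"] pair[of i j] pair[of i' j'] i i' s by simp
  then show ?thesis using pair[of i j] pair[of i' j'] i i' s by auto
qed

text \<open>The hypothesis compares the step from \<open>a\<close> to \<open>a + 1\<close> with the step from \<open>b\<close> to \<open>b + 1\<close> whenever \<open>a + b \<ge> v\<close> and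
  the steps are not adjacent. Every step except the last but one can be compared with the last. The last
  but one can be compared with the step at \<open>2\<close>; this is where \<open>v \<ge> 6\<close> enters.\<close>

lemma constant_differences_of_equal_sums:
  fixes f :: "int \<Rightarrow> int"
  assumes "v \<ge> 6"
    and sums: "\<And>i j i' j'. \<lbrakk>1 \<le> i; i \<le> v; 1 \<le> j; j \<le> v; i \<noteq> j; 1 \<le> i'; i' \<le> v; 1 \<le> j'; j' \<le> v;
      i' \<noteq> j'; i + j = i' + j'; v < i + j\<rbrakk> \<Longrightarrow> f i + f j = f i' + f j'"
    and a: "1 \<le> a" "a < v"
  shows "f (a + 1) - f a = f 2 - f 1"
proof -
  have eq: "f (a + 1) - f a = f (b + 1) - f b"
    if "1 \<le> a" "a + 2 \<le> b" "b < v" "v \<le> a + b" for a b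
    using sums[of "a + 1" b a "b + 1"] that by simp
  have top: "f (a + 1) - f a = f (v - 1 + 1) - f (v - 1)" if "1 \<le> a" "a \<le> v - 3" for a
    using that by (intro eq) auto
  have "f (v - 2 + 1) - f (v - 2) = f (v - 1 + 1) - f (v - 1)"
    using eq[of 2 "v - 2"] top[of 2] \<open>v \<ge> 6\<close> by simp
  moreover have "a \<le> v - 3 \<or> a = v - 2 \<or> a = v - 1" using a by auto
  ultimately have "f (a + 1) - f a = f (v - 1 + 1) - f (v - 1)" using top a by auto
  also have "\<dots> = f (1 + 1) - f 1" using top[of 1] \<open>v \<ge> 6\<close> by simp
  finally show ?thesis by simp
qed

text \<open>The bounds on \<open>d * u\<close> and \<open>d * v\<close> say that the multiples of \<open>d\<close> and of \<open>- d\<close> form two progressions of integers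
  with difference \<open>d\<close>, upwards from \<open>0\<close> and downwards from \<open>l\<close>, without reduction modulo \<open>l\<close>.\<close>

definition small_dilation :: "int \<Rightarrow> int set \<Rightarrow> bool" where
  "small_dilation l T \<longleftrightarrow>
    (\<exists>d u v. dilated_interval l d u v T \<and> 1 \<le> d \<and> d \<le> 4 \<and> d * u < l \<and> d * v < l)"

text \<open>Since \<open>u \<le> v\<close>, a multiplier of absolute value at least \<open>5\<close> would give \<open>5 * v < l \<le> 4 * v + 1\<close>.\<close>

lemma small_dilationI:
  assumes per: "periodic l T" and dil: "dilated_interval l d u v T"
    and "u \<le> v" "d \<noteq> 0" "\<bar>d\<bar> * v < l"
  shows "small_dilation l T"
proof -
  have uv: "1 \<le> u" "1 \<le> v" "l = 2 * u + 2 * v + 1" using dil by (auto simp: dilated_interval_def)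
  have "\<bar>d\<bar> \<le> 4"
  proof (rule ccontr)
    assume "\<not> \<bar>d\<bar> \<le> 4"
    then have "5 * v \<le> \<bar>d\<bar> * v" using uv by (intro mult_right_mono) auto
    then have "5 * v < l" using assms(5) by (rule le_less_trans)
    then show False using \<open>u \<le> v\<close> uv by linarith
  qed
  moreover have "\<bar>d\<bar> * u < l"
    using le_less_trans[OF mult_left_mono[OF \<open>u \<le> v\<close>, of "\<bar>d\<bar>"] assms(5)] by simp
  moreover have "dilated_interval l (- d) v u T" using per dil by (rule dilated_interval_flip)
  ultimately have "(d > 0 \<longrightarrow> dilated_interval l d u v T \<and> 1 \<le> d \<and> d \<le> 4 \<and> d * u < l \<and> d * v < l) \<and>
      (d < 0 \<longrightarrow> dilated_interval l (- d) v u T \<and> 1 \<le> - d \<and> - d \<le> 4 \<and> - d * v < l \<and> - d * u < l)"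
    using dil assms(5) by auto
  then show ?thesis using \<open>d \<noteq> 0\<close> unfolding small_dilation_def by (meson linorder_neqE)
qed

text \<open>The residues of \<open>i * d\<close> with \<open>1 \<le> i \<le> v\<close> form an arithmetic progression of integers between \<open>0\<close> and \<open>l\<close>. Its
  difference is congruent to \<open>d\<close>, hence equal to the first term or smaller by \<open>l\<close>. In either case it is
  a multiplier to which \<open>small_dilationI\<close> applies.\<close>

lemma long_dilated_interval:
  assumes per: "periodic l T" and sided: "one_sided l T" and dil: "dilated_interval l d u v T"
    and uv: "u \<le> v" "6 \<le> v"
  shows "small_dilation l T"
proof -
  have cop: "coprime d l" and l: "l = 2 * u + 2 * v + 1" "1 \<le> u" using dil by (auto simp: dilated_interval_def)
  define f where "f i = (i * d) mod l" for i
  define \<delta> where "\<delta> = f 2 - f 1"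
  have "l > 0" using l uv by linarith
  then have range: "0 \<le> f i" "f i < l" for i by (simp_all add: f_def)
  have diff: "f (a + 1) - f a = \<delta>" if "1 \<le> a" "a < v" for a
    unfolding \<delta>_def f_def
    using constant_differences_of_equal_sums[OF uv(2) _ that, of "\<lambda>i. (i * d) mod l"]
      dilated_interval_sums[OF per sided dil] by blast
  have lin: "f (1 + int m) = f 1 + int m * \<delta>" if "1 + int m \<le> v" for m
    using that
  proof (induction m)
    case (Suc m)
    then show ?case using diff[of "1 + int m"] by (simp add: algebra_simps)
  qed simp
  have fv: "f v = f 1 + (v - 1) * \<delta>" using lin[of "nat (v - 1)"] uv by simp
  have f1: "f 1 \<noteq> 0"
  proof
    assume "f 1 = 0"
    then have "l dvd d" by (simp add: f_def dvd_eq_mod_eq_0)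
    then have "l dvd 1" using cop by (metis coprime_absorb_right dvd_refl coprime_commute)
    then show False using l uv by simp
  qed
  have "[\<delta> = 2 * d - 1 * d] (mod l)"
    unfolding \<delta>_def f_def by (intro cong_diff) (simp_all add: cong_def)
  then have \<delta>d: "[d = \<delta>] (mod l)" by (simp add: cong_sym)
  have f1d: "[d = f 1] (mod l)" by (simp add: f_def cong_def)
  then have "[\<delta> = f 1] (mod l)" using \<delta>d cong_sym cong_trans by blast
  then have "l dvd \<delta> - f 1" by (simp add: cong_iff_dvd_diff)
  then obtain q where q: "\<delta> - f 1 = l * q" by auto
  have "\<delta> - f 1 < l" "\<delta> - f 1 > l * (- 2)" using range[of 1] range[of 2] f1 by (auto simp: \<delta>_def)
  then have "l * q < l * 1" "l * (- 2) < l * q" using q by simp_all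
  then have "q < 1" "- 2 < q" using mult_less_cancel_left_pos[OF \<open>l > 0\<close>] by blast+
  then have "q = 0 \<or> q = - 1" by linarith
  then have "\<bar>\<delta>\<bar> * v < l \<and> \<delta> \<noteq> 0"
  proof
    assume "q = 0"
    then have "\<delta> = f 1" using q by simp
    then show ?thesis using fv range[of v] range[of 1] f1 by (simp add: algebra_simps)
  next
    assume "q = - 1"
    then have \<delta>: "\<delta> = f 1 - l" using q by simp
    then have "f 1 = l + \<delta>" by simp
    then have "f v = l + v * \<delta>" using fv by (simp add: algebra_simps)
    moreover have "f v \<noteq> 0"
    proof
      assume "f v = 0"
      then have "l dvd v * d" by (simp add: f_def dvd_eq_mod_eq_0)
      then have "l dvd v" using cop by (simp add: coprime_dvd_mult_left_iff coprime_commute)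
      then show False using l uv by (auto dest: zdvd_imp_le)
    qed
    moreover have "\<delta> < 0" using \<delta> range[of 1] by simp
    ultimately show ?thesis using range[of v] by (simp add: mult.commute)
  qed
  moreover have "dilated_interval l \<delta> u v T" using per \<delta>d dil by (rule dilated_interval_cong)
  ultimately show ?thesis using small_dilationI[OF per] uv by blast
qed

lemma dilated_interval_mem:
  assumes dil: "dilated_interval l d u v T" and per: "periodic l T" and x: "x \<in> T"
  obtains i where "- u \<le> i" "i \<le> v" "[x = i * d] (mod l)"
proof -
  have cop: "coprime d l" and l: "l = 2 * u + 2 * v + 1" and uv: "1 \<le> u" "1 \<le> v"
    and mem: "\<And>i. \<lbrakk>- u \<le> i; i < l - u\<rbrakk> \<Longrightarrow> i * d \<in> T \<longleftrightarrow> i \<le> v"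
    using dil by (auto simp: dilated_interval_def)
  have "l > 0" using l uv by linarith
  obtain s where s: "[d * s = 1] (mod l)" using cong_solve_coprime_int[OF cop] by blast
  define i where "i = (s * x + u) mod l - u"
  have "0 \<le> (s * x + u) mod l" "(s * x + u) mod l < l" using \<open>l > 0\<close> by simp_all
  then have range: "- u \<le> i" "i < l - u" by (simp_all add: i_def)
  have "[i = s * x + u - u] (mod l)" unfolding i_def by (rule cong_diff) (simp_all add: cong_def)
  then have "[i * d = s * x * d] (mod l)" using cong_scalar_right[of i "s * x" l d] by simp
  moreover have "[d * s * x = 1 * x] (mod l)" using s by (rule cong_scalar_right)
  then have "[s * x * d = x] (mod l)" by (simp add: ac_simps)
  ultimately have xi: "[x = i * d] (mod l)" using cong_sym cong_trans by blast
  then have "i \<le> v" using x mem[OF range] periodicD[OF per] by blast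
  then show ?thesis using that range xi by blast
qed

lemma dilated_interval_residues:
  assumes dil: "dilated_interval l d u v T" and per: "periodic l T"
  shows "T \<inter> {0..<l} = (\<lambda>i. (i * d) mod l) ` {- u..v}"
proof (intro equalityI subsetI)
  fix x assume x: "x \<in> T \<inter> {0..<l}"
  then obtain i where i: "- u \<le> i" "i \<le> v" "[x = i * d] (mod l)"
    using dilated_interval_mem[OF dil per] by blast
  then have "x = (i * d) mod l" using x by (simp add: cong_def)
  then show "x \<in> (\<lambda>i. (i * d) mod l) ` {- u..v}" using i by auto
next
  fix x assume "x \<in> (\<lambda>i. (i * d) mod l) ` {- u..v}"
  then obtain i where i: "- u \<le> i" "i \<le> v" "x = (i * d) mod l" by auto
  have l: "l = 2 * u + 2 * v + 1" "1 \<le> u" "1 \<le> v" using dil by (auto simp: dilated_interval_def)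
  then have "l > 0" "i < l - u" using i by linarith+
  then have "i * d \<in> T" using dil i(1,2) by (simp add: dilated_interval_def)
  then show "x \<in> T \<inter> {0..<l}" using i(3) periodic_mod[OF per] \<open>l > 0\<close> by simp
qed

section \<open>Short intervals and the sporadic sets\<close>

text \<open>The exceptional sets without a parameter, as increasing lists; all of them arise from dilated intervals.\<close>

definition sporadic_sets :: "int list list" where
  "sporadic_sets =
    [[0,1,4,5,6,9], [0,3,4,5,8,9], [0,1,2,5,6,7,11],
     [0,1,3,4,7,8,11], [0,1,4,5,6,10,11], [0,1,4,5,7,8,11],
     [0,1,5,6,7,10,11], [0,3,4,6,7,10,11], [0,3,4,7,8,10,11],
     [0,4,5,6,9,10,11], [0,1,2,6,7,8,12,13], [0,1,4,5,6,9,10,13],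
     [0,1,5,6,7,8,12,13], [0,1,5,6,7,11,12,13], [0,2,3,5,7,8,10,13],
     [0,2,3,5,8,10,11,13], [0,3,4,7,8,9,12,13], [0,3,5,6,8,10,11,13],
     [0,1,2,6,7,8,9,14,15], [0,1,4,5,7,8,11,12,15],
     [0,1,6,7,8,9,13,14,15], [0,3,4,7,8,10,11,14,15],
     [0,1,2,7,8,9,10,15,16,17], [0,1,5,6,7,10,11,12,16,17],
     [0,2,3,5,7,8,10,12,15,17], [0,2,5,7,9,10,12,14,15,17],
     [0,3,4,6,7,10,11,13,14,17]]"

text \<open>The exceptional sets with a parameter; they arise from \<open>five_cosets\<close> with \<open>t = 5 - p\<close>.\<close>

definition five_coset_sets :: "int list list" where
  "five_coset_sets = concat (map (\<lambda>t.
     [[0, 5, 10, t, 5 + t, 10 + t, 15, 5 - t, 10 - t],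
      [0, 5, 10, t, 5 + t, 10 + t, 15, 10 - t, 15 - t]]) [1, 2, 3, 4])"

lemma exceptional_sets_eq: "exceptional_sets = set ` set (sporadic_sets @ five_coset_sets)"
proof -
  have progs: "{5 * i |i::int. i \<in> {0, 1, 2}} = {0, 5, 10}"
    "{5 * i + \<theta> |i::int. i \<in> {0, 1, 2}} = {\<theta>, 5 + \<theta>, 10 + \<theta>}" for \<theta>
    by auto
  have family: "{F \<theta> |\<theta>::int. 1 \<le> \<theta> \<and> \<theta> \<le> 4} = {F 1, F 2, F 3, F 4}" for F :: "int \<Rightarrow> int set"
  proof -
    have "1 \<le> \<theta> \<and> \<theta> \<le> 4 \<longleftrightarrow> \<theta> = 1 \<or> \<theta> = 2 \<or> \<theta> = 3 \<or> \<theta> = 4" for \<theta> :: int by arith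
    then show ?thesis by auto
  qed
  show ?thesis
    unfolding exceptional_sets_def progs family sporadic_sets_def five_coset_sets_def
    by (simp add: insert_commute)
qed

text \<open>For \<open>v \<le> 5\<close>, these equations between consecutive pairs imply all equations of \<open>dilated_interval_sums\<close>; for \<open>v \<le> 3\<close>
  there are none.\<close>

definition balanced_sums :: "int \<Rightarrow> (int \<Rightarrow> int) \<Rightarrow> bool" where
  "balanced_sums v f \<longleftrightarrow> (v = 4 \<longrightarrow> f 1 + f 4 = f 2 + f 3) \<and>
    (v = 5 \<longrightarrow> f 1 + f 5 = f 2 + f 4 \<and> f 2 + f 5 = f 3 + f 4)"

text \<open>A finite search over all \<open>1 \<le> u \<le> v \<le> 5\<close> and all multipliers coprime to the modulus.\<close>

lemma short_interval_check:
  "\<forall>v\<in>set [1..5]. \<forall>u\<in>set [1..v]. \<forall>d\<in>set [1..2 * u + 2 * v].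
    (let l = 2 * u + 2 * v + 1; f = (\<lambda>i. (i * d) mod l) in
      gcd d l = 1 \<longrightarrow> balanced_sums v f \<longrightarrow> balanced_sums u (\<lambda>i. f (- i)) \<longrightarrow>
      d * v < l \<or> (l - d) * v < l \<or> sort (map f [- u..v]) @ [l] \<in> set sporadic_sets)"
  by code_simp

lemma exceptional_card_check:
  "\<forall>xs\<in>set (sporadic_sets @ five_coset_sets). distinct xs \<and> 4 \<le> length xs \<and>
    int (length (remdups [a + b. a \<leftarrow> xs, b \<leftarrow> xs, a < b])) = 3 * int (length xs) - 7"
  by code_simp

lemma five_coset_check:
  "\<forall>p\<in>set [1..4]. \<forall>t\<in>set [p, p + 5]. 
    \<exists>ys\<in>set five_coset_sets. set ys = set (filter (\<lambda>x. x = 15 \<or> 5 dvd x \<or> 5 dvd x + p \<or> x = t \<or> x = t + 5) [0..15])"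
  by code_simp

lemma dilated_interval_balanced_sums:
  assumes "periodic l T" "one_sided l T" "dilated_interval l d u v T"
  shows "balanced_sums v (\<lambda>i. (i * d) mod l)"
  unfolding balanced_sums_def
  using dilated_interval_sums[OF assms, where i = 1 and j = 4 and i' = 2 and j' = 3]
    dilated_interval_sums[OF assms, where i = 1 and j = 5 and i' = 2 and j' = 4]
    dilated_interval_sums[OF assms, where i = 2 and j = 5 and i' = 3 and j' = 4]
  by simp

lemma short_dilated_interval:
  assumes per: "periodic l T" and sided: "one_sided l T" and dil: "dilated_interval l d u v T"
    and uv: "u \<le> v" "v \<le> 5"
  shows "small_dilation l T \<or> insert l (T \<inter> {0..<l}) \<in> set ` set sporadic_sets"
proof -
  have l: "l = 2 * u + 2 * v + 1" "1 \<le> u" "1 \<le> v" and cop: "coprime d l"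
    using dil by (auto simp: dilated_interval_def)
  define r where "r = d mod l"
  have dr: "[d = r] (mod l)" by (simp add: r_def cong_def)
  then have dil': "dilated_interval l r u v T" using dilated_interval_cong[OF per] dil by blast
  then have copr: "gcd r l = 1" unfolding dilated_interval_def coprime_iff_gcd_eq_1 by blast
  have "l > 0" using l by linarith
  then have "0 \<le> r" "r < l" by (simp_all add: r_def)
  moreover have "r \<noteq> 0" using copr l by auto
  ultimately have r: "1 \<le> r" "r \<le> 2 * u + 2 * v" using l by linarith+
  have pos: "balanced_sums v (\<lambda>i. (i * r) mod l)"
    by (rule dilated_interval_balanced_sums[OF per sided dil'])
  have neg: "balanced_sums u (\<lambda>i. (- i * r) mod l)"
    using dilated_interval_balanced_sums[OF per sided dilated_interval_flip[OF per dil']] by simp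
  have "r * v < l \<or> (l - r) * v < l \<or>
      sort (map (\<lambda>i. (i * r) mod l) [- u..v]) @ [l] \<in> set sporadic_sets"
    using short_interval_check[unfolded Let_def, rule_format, of v u r] uv l(2,3) r copr pos neg
    unfolding l(1)[symmetric] by simp
  then show ?thesis
  proof (elim disjE)
    assume "r * v < l"
    then show ?thesis using small_dilationI[OF per dil' uv(1)] r by simp
  next
    assume "(l - r) * v < l"
    moreover have "dilated_interval l (r - l) u v T"
      using dilated_interval_cong[OF per _ dil'] by (simp add: cong_iff_dvd_diff)
    ultimately show ?thesis using small_dilationI[OF per _ uv(1), of "r - l"] \<open>r < l\<close> by simp
  next
    assume "sort (map (\<lambda>i. (i * r) mod l) [- u..v]) @ [l] \<in> set sporadic_sets"
    then have "set (sort (map (\<lambda>i. (i * r) mod l) [- u..v]) @ [l]) \<in> set ` set sporadic_sets"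
      by (rule imageI)
    moreover have "set (sort (map (\<lambda>i. (i * r) mod l) [- u..v]) @ [l]) = insert l (T \<inter> {0..<l})"
      using dilated_interval_residues[OF dil' per] by simp
    ultimately show ?thesis by simp
  qed
qed

section \<open>Counting the sumset\<close>

text \<open>The hypotheses of the theorem without the enumeration of \<open>A\<close>.\<close>

locale endpoint_set =
  fixes k :: nat and A :: "int set" and l :: int
  assumes k_ge_3: "k \<ge> 3" and finite_A: "finite A" and card_A: "card A = k"
    and A_sub: "A \<subseteq> {0..l}" and zero_A: "0 \<in> A" and l_A: "l \<in> A" and l_def: "l = 2 * int k - 3"
begin

definition T where "T = {x. x mod l \<in> A}"

lemma l_pos: "l > 0" and odd_l: "odd l"
  using k_ge_3 by (simp_all add: l_def)

lemma T_periodic: "periodic l T"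
  by (simp add: periodic_def T_def cong_def)

lemma mem_T_iff: "0 \<le> x \<Longrightarrow> x < l \<Longrightarrow> x \<in> T \<longleftrightarrow> x \<in> A"
  by (simp add: T_def)

lemma zero_T: "0 \<in> T" using zero_A by (simp add: T_def)

lemma card_T: "2 * int (card (T \<inter> {0..<l})) = l + 1"
proof -
  have "T \<inter> {0..<l} = A - {l}" using A_sub mem_T_iff by fastforce
  then have "card (T \<inter> {0..<l}) = k - 1" using l_A card_A by simp
  then show ?thesis using k_ge_3 by (simp add: l_def)
qed

text \<open>A gap \<open>c\<close> contributes the elements \<open>c\<close> and \<open>c + l\<close> to the sumset, according to whether it is in \<open>low\<close> and in
  \<open>high\<close>.\<close>

definition gaps where "gaps = {1..<l} - A"
definition low where "low = {c \<in> gaps. c \<in> restricted_sumset A}"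
definition high where "high = {c \<in> gaps. c + l \<in> restricted_sumset A}"

lemma gaps_not_T: "c \<in> gaps \<Longrightarrow> c \<notin> T"
  by (auto simp: gaps_def mem_T_iff)

lemma gaps_range: "c \<in> gaps \<Longrightarrow> 0 < c \<and> c < l"
  by (simp add: gaps_def)

lemma mod_in_gaps:
  assumes "c \<notin> T"
  shows "c mod l \<in> gaps"
proof -
  have "c mod l \<notin> A" using assms by (simp add: T_def)
  moreover from this have "c mod l \<noteq> 0" using zero_A by auto
  moreover have "0 \<le> c mod l" "c mod l < l" using l_pos by simp_all
  ultimately show ?thesis by (simp add: gaps_def)
qed

lemma card_gaps: "card gaps = k - 2"
proof -
  have "A \<inter> {1..<l} = A - {0, l}" using A_sub by auto
  moreover have "card (A - {0, l}) = k - 2" using zero_A l_A l_pos card_A by simp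
  moreover have "card gaps = card {1..<l} - card (A \<inter> {1..<l})"
    unfolding gaps_def using finite_A by (metis Int_commute card_Diff_subset_Int finite_Int)
  moreover have "card {1..<l} = 2 * k - 4" by (simp add: l_def nat_diff_distrib)
  ultimately show ?thesis using k_ge_3 by simp
qed

text \<open>The first two parts are the sums with \<open>0\<close> and the sums with \<open>l\<close>; the other sums fall on a gap, possibly
  translated by \<open>l\<close>.\<close>

lemma sumset_decomposition:
  "restricted_sumset A = (A - {0}) \<union> (+) l ` (A - {0, l}) \<union> low \<union> (+) l ` high"
proof (intro equalityI subsetI)
  fix w assume w: "w \<in> restricted_sumset A"
  then obtain a b where ab: "w = a + b" "a \<in> A" "b \<in> A" "a \<noteq> b" by (auto simp: restricted_sumset_def)
  moreover from this have "0 \<le> a" "a \<le> l" "0 \<le> b" "b \<le> l" using A_sub by auto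
  ultimately have range: "0 < w" "w < 2 * l" by linarith+
  consider "w \<in> A" | "w < l" "w \<notin> A" | "l < w" "w - l \<in> A" | "l < w" "w - l \<notin> A"
    using l_A by (metis linorder_neqE)
  then show "w \<in> (A - {0}) \<union> (+) l ` (A - {0, l}) \<union> low \<union> (+) l ` high"
  proof cases
    case 2
    then show ?thesis using w range by (simp add: low_def gaps_def)
  next
    case 3
    then have "w - l \<in> A - {0, l}" "w = l + (w - l)" using range by auto
    then show ?thesis by blast
  next
    case 4
    then have "w - l \<in> high" "w = l + (w - l)" using w range by (simp_all add: high_def gaps_def)
    then show ?thesis by blast
  qed (use range in auto)
next
  fix w assume "w \<in> (A - {0}) \<union> (+) l ` (A - {0, l}) \<union> low \<union> (+) l ` high"
  then show "w \<in> restricted_sumset A"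
    using zero_A l_A unfolding low_def high_def restricted_sumset_def
    by (auto simp: add.commute; metis add.right_neutral)
qed

lemma finite_gaps: "finite gaps" "finite low" "finite high"
proof -
  show gaps: "finite gaps" by (simp add: gaps_def)
  show "finite low" "finite high" by (simp_all add: low_def high_def gaps)
qed

lemma card_sumset_low_high:
  "int (card (restricted_sumset A)) = 2 * int k - 3 + int (card low) + int (card high)"
proof -
  have "card (A - {0} \<union> (+) l ` (A - {0, l}) \<union> low \<union> (+) l ` high) =
      card (A - {0}) + card ((+) l ` (A - {0, l})) + card low + card ((+) l ` high)"
  proof -
    have "x \<le> l" if "x \<in> A - {0}" for x using that A_sub by auto
    moreover have "l < x" if "x \<in> (+) l ` (A - {0, l})" for x using that A_sub by force
    ultimately have "(A - {0}) \<inter> (+) l ` (A - {0, l}) = {}" by force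
    moreover have "(A - {0} \<union> (+) l ` (A - {0, l}) \<union> low) \<inter> (+) l ` high = {}"
      using A_sub by (auto simp: high_def low_def gaps_def)
    moreover have "(A - {0} \<union> (+) l ` (A - {0, l})) \<inter> low = {}"
      using A_sub by (auto simp: low_def gaps_def)
    ultimately show ?thesis using finite_A finite_gaps by (simp add: card_Un_disjoint)
  qed
  moreover have "card ((+) l ` (A - {0, l})) = k - 2"
    using zero_A l_A l_pos card_A by (simp add: card_image)
  moreover have "card ((+) l ` high) = card high" by (simp add: card_image)
  moreover have "card (A - {0}) = k - 1" using zero_A card_A by simp
  ultimately show ?thesis using k_ge_3 unfolding sumset_decomposition by simp
qed

text \<open>A sum equal to a gap \<open>c\<close> involves neither \<open>0\<close> nor \<open>l\<close>, so it is a representation of \<open>c\<close> modulo \<open>l\<close> without carry.\<close>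

lemma low_iff:
  assumes c: "c \<in> gaps"
  shows "c \<in> low \<longleftrightarrow> (\<exists>x\<in>T. c - x \<in> T \<and> \<not> [2 * x = c] (mod l) \<and> x mod l < c)"
proof
  assume "c \<in> low"
  then obtain a b where ab: "c = a + b" "a \<in> A" "b \<in> A" "a \<noteq> b"
    by (auto simp: low_def restricted_sumset_def)
  have ab0: "0 < a" "0 < b"
    using ab c A_sub unfolding gaps_def by (metis DiffD2 add.right_neutral add_0 atLeastAtMost_iff order_le_less subsetD)+
  then have abl: "a < l" "b < l" using ab gaps_range[OF c] by auto
  then have T: "a \<in> T" "c - a \<in> T" using ab ab0 mem_T_iff by simp_all
  have "\<not> [2 * a = c] (mod l)"
  proof
    assume "[2 * a = c] (mod l)"
    then have "[a + a = a + b] (mod l)" using ab(1) by simp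
    then have "[a = b] (mod l)" by (simp only: cong_add_lcancel)
    then show False using ab ab0 abl eq_of_cong_residues by force
  qed
  then show "\<exists>x\<in>T. c - x \<in> T \<and> \<not> [2 * x = c] (mod l) \<and> x mod l < c"
    using T ab ab0 abl by (intro bexI[of _ a]) simp_all
next
  assume "\<exists>x\<in>T. c - x \<in> T \<and> \<not> [2 * x = c] (mod l) \<and> x mod l < c"
  then obtain x where x: "x \<in> T" "c - x \<in> T" "\<not> [2 * x = c] (mod l)" "x mod l < c" by blast
  define a where "a = x mod l"
  have xa: "[x = a] (mod l)" by (simp add: a_def cong_def)
  have "0 \<le> a" using l_pos by (simp add: a_def)
  have "c - a \<in> T" using x(2) periodicD[OF T_periodic cong_diff[OF cong_refl xa]] by blast
  then have "c - a \<in> A" using mem_T_iff[of "c - a"] x(4) \<open>0 \<le> a\<close> gaps_range[OF c]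
    unfolding a_def by linarith
  moreover have "a \<in> A" using x(1) by (simp add: T_def a_def)
  moreover have "a \<noteq> c - a"
  proof
    assume "a = c - a"
    then have "c = 2 * a" by simp
    then show False using x(3) cong_scalar_left[OF xa, of 2] by simp
  qed
  moreover have "c = a + (c - a)" by simp
  ultimately show "c \<in> low" using c unfolding low_def restricted_sumset_def by blast
qed

text \<open>A sum equal to \<open>c + l\<close> is likewise a representation of \<open>c\<close> modulo \<open>l\<close> with carry.\<close>

lemma high_iff:
  assumes c: "c \<in> gaps"
  shows "c \<in> high \<longleftrightarrow> (\<exists>x\<in>T. c - x \<in> T \<and> \<not> [2 * x = c] (mod l) \<and> \<not> x mod l < c)"
proof
  assume "c \<in> high"
  then obtain a b where ab: "c + l = a + b" "a \<in> A" "b \<in> A" "a \<noteq> b"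
    by (auto simp: high_def restricted_sumset_def)
  have "c \<notin> A" using c by (simp add: gaps_def)
  then have "a \<noteq> l" "b \<noteq> l" using ab by auto
  then have abl: "0 \<le> a" "a < l" "0 \<le> b" "b < l" using ab A_sub by (auto simp: order_le_less)
  then have "a \<in> T" "b \<in> T" using ab mem_T_iff by simp_all
  have "b - (c - a) = l" using ab(1) by simp
  then have "[b = c - a] (mod l)" by (simp only: cong_iff_dvd_diff dvd_refl)
  then have T: "a \<in> T" "c - a \<in> T" using \<open>a \<in> T\<close> \<open>b \<in> T\<close> periodicD[OF T_periodic] by blast+
  have "\<not> [2 * a = c] (mod l)"
  proof
    assume "[2 * a = c] (mod l)"
    then have "[2 * a = c + l] (mod l)" by (simp add: cong_def)
    then have "[a + a = a + b] (mod l)" using ab(1) by simp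
    then have "[a = b] (mod l)" by (simp only: cong_add_lcancel)
    then show False using ab abl eq_of_cong_residues by blast
  qed
  then show "\<exists>x\<in>T. c - x \<in> T \<and> \<not> [2 * x = c] (mod l) \<and> \<not> x mod l < c"
    using T ab abl by (intro bexI[of _ a]) simp_all
next
  assume "\<exists>x\<in>T. c - x \<in> T \<and> \<not> [2 * x = c] (mod l) \<and> \<not> x mod l < c"
  then obtain x where x: "x \<in> T" "c - x \<in> T" "\<not> [2 * x = c] (mod l)" "c \<le> x mod l" by auto
  define a where "a = x mod l"
  have xa: "[x = a] (mod l)" by (simp add: a_def cong_def)
  have "0 \<le> a" "a < l" using l_pos by (simp_all add: a_def)
  have "a \<in> A" using x(1) by (simp add: T_def a_def)
  then have "c \<noteq> a" using c by (auto simp: gaps_def)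
  have "c - a \<in> T" using x(2) periodicD[OF T_periodic cong_diff[OF cong_refl xa]] by blast
  moreover have "[c - a = c + l - a] (mod l)" by (simp add: cong_iff_dvd_diff)
  ultimately have "c + l - a \<in> T" using periodicD[OF T_periodic] by blast
  then have "c + l - a \<in> A"
    using mem_T_iff[of "c + l - a"] x(4) \<open>a < l\<close> \<open>c \<noteq> a\<close> gaps_range[OF c]
    unfolding a_def by linarith
  moreover have "a \<noteq> c + l - a"
  proof
    assume "a = c + l - a"
    then have "2 * a = c + l" by simp
    then have "[2 * a = c] (mod l)" by (simp add: cong_def)
    then show False using x(3) cong_scalar_left[OF xa, of 2] cong_trans by blast
  qed
  moreover have "c + l = a + (c + l - a)" by simp
  ultimately show "c \<in> high" using c \<open>a \<in> A\<close> unfolding high_def restricted_sumset_def by blast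
qed

lemma not_low_high_iff:
  assumes "c \<in> gaps"
  shows "c \<notin> low \<union> high \<longleftrightarrow> unrepresented l T c"
  using low_iff[OF assms] high_iff[OF assms] unfolding unrepresented_def by blast

lemma low_high_disjoint_iff: "low \<inter> high = {} \<longleftrightarrow> one_sided l T"
proof
  assume disj: "low \<inter> high = {}"
  show "one_sided l T"
    unfolding one_sided_def
  proof (intro allI impI)
    fix c x y
    assume asm: "c \<notin> T \<and> x \<in> T \<and> c - x \<in> T \<and> \<not> [2 * x = c] (mod l) \<and>
      y \<in> T \<and> c - y \<in> T \<and> \<not> [2 * y = c] (mod l)"
    define c' where "c' = c mod l"
    have cc': "[c = c'] (mod l)" by (simp add: c'_def cong_def)
    have c': "c' \<in> gaps" using asm mod_in_gaps by (simp add: c'_def)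
    have "c' - z \<in> T \<and> \<not> [2 * z = c'] (mod l)" if "c - z \<in> T" "\<not> [2 * z = c] (mod l)" for z
      using that periodicD[OF T_periodic cong_diff[OF cc' cong_refl]] cc' cong_sym cong_trans by blast
    then have rep: "x \<in> T" "c' - x \<in> T" "\<not> [2 * x = c'] (mod l)"
      "y \<in> T" "c' - y \<in> T" "\<not> [2 * y = c'] (mod l)" using asm by blast+
    show "x mod l < c mod l \<longleftrightarrow> y mod l < c mod l"
      using disj rep low_iff[OF c'] high_iff[OF c'] unfolding c'_def[symmetric] by blast
  qed
next
  assume sided: "one_sided l T"
  show "low \<inter> high = {}"
  proof (rule ccontr)
    assume "low \<inter> high \<noteq> {}"
    then obtain c where c: "c \<in> low" "c \<in> high" by blast
    then have gap: "c \<in> gaps" by (simp add: low_def)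
    obtain x y where x: "x \<in> T" "c - x \<in> T" "\<not> [2 * x = c] (mod l)" "x mod l < c"
      and y: "y \<in> T" "c - y \<in> T" "\<not> [2 * y = c] (mod l)" "\<not> y mod l < c"
      using low_iff[OF gap] high_iff[OF gap] c by blast
    have "c mod l = c" using gaps_range[OF gap] by simp
    then show False
      using one_sidedD[OF sided gaps_not_T[OF gap] x(1-3) y(1-3)] x(4) y(4) by simp
  qed
qed

text \<open>Inclusion and exclusion for the gaps in \<open>low\<close> and in \<open>high\<close>: the second summand on the left counts unrepresented gaps,
  the last one on the right counts double gaps.\<close>

lemma card_sumset:
  "int (card (restricted_sumset A)) + int (card (gaps - (low \<union> high))) = 3 * int k - 5 + int (card (low \<inter> high))"
proof -
  have "low \<union> high \<subseteq> gaps" by (auto simp: low_def high_def)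
  then have "card (gaps - (low \<union> high)) = card gaps - card (low \<union> high)" "card (low \<union> high) \<le> card gaps"
    using finite_gaps by (simp_all add: card_Diff_subset card_mono)
  moreover have "card low + card high = card (low \<union> high) + card (low \<inter> high)"
    using finite_gaps by (intro card_Un_Int) auto
  ultimately show ?thesis using card_sumset_low_high card_gaps k_ge_3 by linarith
qed

lemma two_unrepresented_imp_two_centres:
  assumes "unrepresented l T c\<^sub>1" "unrepresented l T c\<^sub>2" "\<not> [c\<^sub>1 = c\<^sub>2] (mod l)"
  obtains h e where "two_centres l T h e" "[2 * h = c\<^sub>1] (mod l)" "[2 * (h + e) = c\<^sub>2] (mod l)"
proof -
  obtain h where h: "[2 * h = c\<^sub>1] (mod l)" "centre l T h"
    using unrepresented_imp_centre[OF odd_l l_pos T_periodic card_T assms(1)] .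
  obtain h' where h': "[2 * h' = c\<^sub>2] (mod l)" "centre l T h'"
    using unrepresented_imp_centre[OF odd_l l_pos T_periodic card_T assms(2)] .
  have "\<not> l dvd h' - h"
  proof
    assume "l dvd h' - h"
    then have "[h' = h] (mod l)" by (simp add: cong_iff_dvd_diff)
    then have "[2 * h = 2 * h'] (mod l)" using cong_scalar_left cong_sym by blast
    then show False using assms(3) h(1) h'(1) cong_sym cong_trans by blast
  qed
  then have "two_centres l T h (h' - h)"
    using odd_l l_pos T_periodic h h' by (simp add: two_centres_def)
  then show ?thesis using that[of h "h' - h"] h h' by simp
qed

text \<open>Halves of unrepresented gaps are centres, of which there are at most two.\<close>

lemma card_unrepresented_gaps:
  assumes "c\<^sub>1 \<in> gaps - (low \<union> high)" "c\<^sub>2 \<in> gaps - (low \<union> high)" "c\<^sub>1 \<noteq> c\<^sub>2"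
  shows "gaps - (low \<union> high) = {c\<^sub>1, c\<^sub>2}"
proof -
  have neq: "\<not> [x = y] (mod l)" if "x \<in> gaps" "y \<in> gaps" "x \<noteq> y" for x y
    using that gaps_range eq_of_cong_residues by (metis order_less_imp_le)
  have unrep: "unrepresented l T c" if "c \<in> gaps - (low \<union> high)" for c
    using that not_low_high_iff by blast
  obtain h e where he: "two_centres l T h e" "[2 * h = c\<^sub>1] (mod l)" "[2 * (h + e) = c\<^sub>2] (mod l)"
    using two_unrepresented_imp_two_centres[OF unrep[OF assms(1)] unrep[OF assms(2)]] neq assms by blast
  have "c = c\<^sub>1 \<or> c = c\<^sub>2" if c: "c \<in> gaps - (low \<union> high)" for c
  proof -
    obtain h' where h': "[2 * h' = c] (mod l)" "centre l T h'"
      using unrepresented_imp_centre[OF odd_l l_pos T_periodic card_T unrep[OF c]] by blast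
    have "[h' = h] (mod l) \<or> [h' = h + e] (mod l)"
      using he(1) h'(2) by (rule two_centres.at_most_two_centres)
    then have "[2 * h' = 2 * h] (mod l) \<or> [2 * h' = 2 * (h + e)] (mod l)"
      by (simp only: cong_double_cancel[OF odd_l])
    then have "[c = c\<^sub>1] (mod l) \<or> [c = c\<^sub>2] (mod l)" using h'(1) he(2,3) cong_sym cong_trans by blast
    then show ?thesis using neq c assms by blast
  qed
  then show ?thesis using assms by blast
qed

text \<open>A deficit of two relative to \<open>3 k - 5\<close> needs at least two unrepresented gaps. Since there are no more than
  two, no deficit is left to compensate for double gaps.\<close>

lemma card_sumset_imp_extremal:
  assumes "int (card (restricted_sumset A)) = 3 * int k - 7"
  obtains h e where "extremal l T h e"
proof -
  define U where "U = gaps - (low \<union> high)"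
  have cardU: "card U = 2 + card (low \<inter> high)" using card_sumset assms by (simp add: U_def)
  then obtain c\<^sub>1 where c1: "c\<^sub>1 \<in> U" by (metis card.empty add_is_0 ex_in_conv zero_neq_numeral)
  have "card (U - {c\<^sub>1}) = 1 + card (low \<inter> high)" using cardU c1 by simp
  then have "U - {c\<^sub>1} \<noteq> {}" by (metis card.empty add_is_0 zero_neq_one)
  then obtain c\<^sub>2 where c2: "c\<^sub>2 \<in> U" "c\<^sub>1 \<noteq> c\<^sub>2" by blast
  have "U = {c\<^sub>1, c\<^sub>2}" using card_unrepresented_gaps c1 c2 by (simp add: U_def)
  then have "card (low \<inter> high) = 0" using cardU c2 by simp
  then have "low \<inter> high = {}" using finite_gaps by simp
  then have sided: "one_sided l T" by (simp add: low_high_disjoint_iff)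
  have unrep: "unrepresented l T c\<^sub>1" "unrepresented l T c\<^sub>2"
    using c1 c2 not_low_high_iff by (auto simp: U_def)
  have gap: "c\<^sub>1 \<in> gaps" "c\<^sub>2 \<in> gaps" using c1 c2 by (auto simp: U_def)
  then have "\<not> [c\<^sub>1 = c\<^sub>2] (mod l)"
    using c2(2) gaps_range eq_of_cong_residues by (metis order_less_imp_le)
  then obtain h e where he: "two_centres l T h e" "[2 * h = c\<^sub>1] (mod l)" "[2 * (h + e) = c\<^sub>2] (mod l)"
    using two_unrepresented_imp_two_centres unrep by blast
  have "2 * h \<notin> T" "2 * (h + e) \<notin> T"
    using he(2,3) gaps_not_T[OF gap(1)] gaps_not_T[OF gap(2)] periodicD[OF T_periodic] by blast+
  then have "extremal l T h e"
    using he(1) zero_T sided by (simp add: extremal_def extremal_axioms_def)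
  then show ?thesis by (rule that)
qed

lemma card_sumsetI:
  assumes sided: "one_sided l T" and c: "c\<^sub>1 \<notin> T" "c\<^sub>2 \<notin> T" "\<not> [c\<^sub>1 = c\<^sub>2] (mod l)"
    and unrep: "unrepresented l T c\<^sub>1" "unrepresented l T c\<^sub>2"
  shows "int (card (restricted_sumset A)) = 3 * int k - 7"
proof -
  have U: "c mod l \<in> gaps - (low \<union> high)" if "c \<notin> T" "unrepresented l T c" for c
  proof -
    have cc: "[c mod l = c] (mod l)" by (simp add: cong_def)
    have "unrepresented l T (c mod l)"
      unfolding unrepresented_def
    proof (intro ballI impI)
      fix x assume "x \<in> T" "c mod l - x \<in> T"
      then have "c - x \<in> T" using periodicD[OF T_periodic cong_diff[OF cc cong_refl]] by blast
      then have "[2 * x = c] (mod l)" using that(2) \<open>x \<in> T\<close> by (simp add: unrepresented_def)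
      then show "[2 * x = c mod l] (mod l)" using cc cong_sym cong_trans by blast
    qed
    then show ?thesis using not_low_high_iff mod_in_gaps[OF that(1)] by blast
  qed
  have "c\<^sub>1 mod l \<noteq> c\<^sub>2 mod l" using c(3) by (simp add: cong_def)
  then have "card (gaps - (low \<union> high)) = 2"
    using card_unrepresented_gaps[OF U[OF c(1) unrep(1)] U[OF c(2) unrep(2)]] by simp
  moreover have "low \<inter> high = {}" using sided by (simp add: low_high_disjoint_iff)
  ultimately show ?thesis using card_sumset by simp
qed

end

section \<open>The families attain the bound\<close>

lemma residue_less_iff:
  fixes l :: int
  assumes "l > 0" "\<not> [x = c] (mod l)"
  shows "x mod l < c mod l \<longleftrightarrow> x mod l + (c - x) mod l = c mod l"
proof -
  have "(c - x) mod l \<noteq> 0" using assms(2) by (metis cong_iff_dvd_diff cong_sym_eq mod_eq_0_iff_dvd)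
  moreover have "0 \<le> x mod l" "x mod l < l" "0 \<le> (c - x) mod l" "(c - x) mod l < l"
    using assms by simp_all
  moreover have "c mod l = (x mod l + (c - x) mod l) mod l" by (simp add: mod_add_eq)
  then have "c mod l = (if x mod l + (c - x) mod l < l
      then x mod l + (c - x) mod l else x mod l + (c - x) mod l - l)"
    using calculation by (simp only: mod_add_residues)
  ultimately show ?thesis by (auto split: if_splits)
qed

text \<open>The sums of residues in question differ by a multiple of \<open>l\<close>, so comparing them is comparing carries.\<close>

lemma one_sidedI:
  assumes "l > 0" and per: "periodic l T"
    and sums: "\<And>c x y. \<lbrakk>c \<notin> T; x \<in> T; c - x \<in> T; y \<in> T; c - y \<in> T\<rbrakk>
      \<Longrightarrow> x mod l + (c - x) mod l = y mod l + (c - y) mod l"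
  shows "one_sided l T"
  unfolding one_sided_def
proof (intro allI impI, elim conjE)
  fix c x y assume "c \<notin> T" "x \<in> T" "c - x \<in> T" "y \<in> T" "c - y \<in> T"
  moreover from this have "\<not> [x = c] (mod l)" "\<not> [y = c] (mod l)" using periodicD[OF per] by blast+
  ultimately show "x mod l < c mod l \<longleftrightarrow> y mod l < c mod l"
    using residue_less_iff[OF \<open>l > 0\<close>] sums by metis
qed

text \<open>The parameter \<open>2 * v\<close> is extremal among the sums of two parameters, hence it occurs only as \<open>v + v\<close>. The other
  end of the interval is covered by \<open>dilated_interval_flip\<close>.\<close>

lemma dilated_interval_unrepresented:
  assumes dil: "dilated_interval l d u v T" and per: "periodic l T"
  shows "2 * v * d \<notin> T" "unrepresented l T (2 * v * d)"
proof -
  have l: "l = 2 * u + 2 * v + 1" and uv: "1 \<le> u" "1 \<le> v"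
    and mem: "\<And>i. \<lbrakk>- u \<le> i; i < l - u\<rbrakk> \<Longrightarrow> i * d \<in> T \<longleftrightarrow> i \<le> v"
    using dil by (auto simp: dilated_interval_def)
  show "2 * v * d \<notin> T" using mem[of "2 * v"] l uv by simp
  show "unrepresented l T (2 * v * d)"
    unfolding unrepresented_def
  proof (intro ballI impI)
    fix x assume x: "x \<in> T" "2 * v * d - x \<in> T"
    obtain i where i: "- u \<le> i" "i \<le> v" "[x = i * d] (mod l)"
      using dilated_interval_mem[OF dil per x(1)] .
    have "[2 * v * d - x = 2 * v * d - i * d] (mod l)" using i(3) by (intro cong_diff cong_refl)
    then have "(2 * v - i) * d \<in> T" using x(2) periodicD[OF per] by (simp add: left_diff_distrib)
    then have "2 * v - i \<le> v" using mem[of "2 * v - i"] i l uv by simp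
    then have "i = v" using i by simp
    then show "[2 * x = 2 * v * d] (mod l)" using cong_scalar_left[OF i(3), of 2] by (simp add: mult.assoc)
  qed
qed

text \<open>Two parameters with a sum \<open>s\<close> outside \<open>{- u..v}\<close> have the same sign. Without reduction modulo \<open>l\<close>, the two
  residues then add up to \<open>s * d\<close> or to \<open>s * d + 2 * l\<close>, which depends on \<open>s\<close> only. Sums of two parameters
  range over \<open>l\<close> consecutive integers, so \<open>c\<close> determines \<open>s\<close>.\<close>

lemma small_dilation_one_sided:
  assumes dil: "dilated_interval l d u v T" and per: "periodic l T"
    and d: "d > 0" "d * u < l" "d * v < l"
  shows "one_sided l T"
proof (rule one_sidedI[OF _ per])
  have l: "l = 2 * u + 2 * v + 1" and uv: "1 \<le> u" "1 \<le> v" and cop: "coprime d l"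
    and mem: "\<And>i. \<lbrakk>- u \<le> i; i < l - u\<rbrakk> \<Longrightarrow> i * d \<in> T \<longleftrightarrow> i \<le> v"
    using dil by (auto simp: dilated_interval_def)
  show "l > 0" using l uv by linarith
  have sum: "\<exists>s. [c = s * d] (mod l) \<and> - 2 * u \<le> s \<and> s \<le> 2 * v \<and>
      x mod l + (c - x) mod l = s * d + (if s > v then 0 else 2 * l)"
    if cx: "c \<notin> T" "x \<in> T" "c - x \<in> T" for c x
  proof -
    obtain i where i: "- u \<le> i" "i \<le> v" "[x = i * d] (mod l)"
      using dilated_interval_mem[OF dil per cx(2)] .
    obtain j where j: "- u \<le> j" "j \<le> v" "[c - x = j * d] (mod l)"
      using dilated_interval_mem[OF dil per cx(3)] .
    have "[x + (c - x) = i * d + j * d] (mod l)" using i(3) j(3) by (rule cong_add)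
    then have c: "[c = (i + j) * d] (mod l)" by (simp add: distrib_right)
    then have "(i + j) * d \<notin> T" using cx(1) periodicD[OF per] by blast
    then have out: "i + j < - u \<or> v < i + j" using mem[of "i + j"] l i j by linarith
    have nonneg: "z mod l = m * d" if "0 \<le> m" "m \<le> v" "[z = m * d] (mod l)" for z m
    proof -
      have "m * d \<le> v * d" using that d by (intro mult_right_mono) auto
      then have "m * d < l" using d(3) mult.commute[of v d] by linarith
      then have "(m * d) mod l = m * d" using that d by (intro mod_pos_pos_trivial) auto
      then show ?thesis using that(3) by (simp add: cong_def)
    qed
    have negative: "z mod l = m * d + l" if "m < 0" "- u \<le> m" "[z = m * d] (mod l)" for z m
    proof -
      have "- m * d \<le> u * d" using that d by (intro mult_right_mono) auto
      then have "- (m * d) < l" using d(2) mult.commute[of u d] by simp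
      moreover have "m * d < 0" using that(1) d(1) by (rule mult_neg_pos)
      ultimately have "(m * d + l) mod l = m * d + l"
        by (intro mod_pos_pos_trivial) auto
      then show ?thesis using that(3) by (simp add: cong_def)
    qed
    have "x mod l + (c - x) mod l = (i + j) * d + (if i + j > v then 0 else 2 * l)"
    proof (cases "i + j > v")
      case True
      then have "0 \<le> i" "0 \<le> j" using i j by linarith+
      then show ?thesis using nonneg[of i x] nonneg[of j "c - x"] i j True by (simp add: distrib_right)
    next
      case False
      then have "i < 0" "j < 0" using out i j by linarith+
      then show ?thesis using negative[of i x] negative[of j "c - x"] i j False by (simp add: distrib_right)
    qed
    moreover have "- 2 * u \<le> i + j" "i + j \<le> 2 * v" using i j by linarith+
    ultimately show ?thesis using c by blast
  qed
  fix c x y assume asm: "c \<notin> T" "x \<in> T" "c - x \<in> T" "y \<in> T" "c - y \<in> T"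
  obtain s where s: "[c = s * d] (mod l)" "- 2 * u \<le> s" "s \<le> 2 * v"
    "x mod l + (c - x) mod l = s * d + (if s > v then 0 else 2 * l)" using sum[of c x] asm by blast
  obtain t where t: "[c = t * d] (mod l)" "- 2 * u \<le> t" "t \<le> 2 * v"
    "y mod l + (c - y) mod l = t * d + (if t > v then 0 else 2 * l)" using sum[of c y] asm by blast
  have "[s * d = t * d] (mod l)" using s(1) t(1) cong_sym cong_trans by blast
  then have "[s = t] (mod l)" using cong_mult_rcancel[OF cop] by blast
  moreover have "\<bar>s - t\<bar> < l" using s(2,3) t(2,3) l by linarith
  ultimately have "s = t" by (rule cong_int_bound)
  then show "x mod l + (c - x) mod l = y mod l + (c - y) mod l" using s(4) t(4) by simp
qed

context endpoint_set
begin

lemma card_sumset_small_dilation: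
  assumes dil: "dilated_interval l d u v T" and d: "d > 0" "d * u < l" "d * v < l"
  shows "int (card (restricted_sumset A)) = 3 * int k - 7"
proof (rule card_sumsetI)
  have l: "l = 2 * u + 2 * v + 1" and uv: "1 \<le> u" "1 \<le> v" and cop: "coprime d l"
    using dil by (auto simp: dilated_interval_def)
  note flip = dilated_interval_flip[OF T_periodic dil]
  show "one_sided l T" by (rule small_dilation_one_sided[OF dil T_periodic d])
  show "2 * v * d \<notin> T" "unrepresented l T (2 * v * d)"
    by (rule dilated_interval_unrepresented[OF dil T_periodic])+
  show "2 * u * - d \<notin> T" "unrepresented l T (2 * u * - d)"
    by (rule dilated_interval_unrepresented[OF flip T_periodic])+
  show "\<not> [2 * v * d = 2 * u * - d] (mod l)"
  proof
    assume "[2 * v * d = 2 * u * - d] (mod l)"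
    then have "[2 * v * d = (- 2 * u) * d] (mod l)" by simp
    then have "[2 * v = - 2 * u] (mod l)" using cong_mult_rcancel[OF cop] by blast
    moreover have "\<bar>2 * v - (- 2 * u)\<bar> < l" using l uv by linarith
    ultimately have "2 * v = - 2 * u" by (rule cong_int_bound)
    then show False using uv by linarith
  qed
qed

lemma A_eq: "A = insert l (T \<inter> {0..<l})"
  using A_sub l_A mem_T_iff by fastforce

text \<open>The residue of \<open>i * d\<close> is \<open>d * i\<close> for \<open>i \<ge> 0\<close>, and that of \<open>- i * d\<close> is \<open>l - d * i\<close> for \<open>i > 0\<close>. The element \<open>l\<close> of
  \<open>A\<close> appears on the right as \<open>l - d * 0\<close>.\<close>

lemma dilated_interval_iff:
  assumes "coprime d l" "1 \<le> u" "1 \<le> v" "u + v = int k - 2" "d > 0" "d * u < l" "d * v < l"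
  shows "dilated_interval l d u v T \<longleftrightarrow> A = (\<lambda>i. d * i) ` {0..v} \<union> (\<lambda>i. l - d * i) ` {0..u}"
proof -
  have l: "l = 2 * u + 2 * v + 1" using assms(4) l_def by linarith
  have nonneg: "(i * d) mod l = d * i" if "0 \<le> i" "i \<le> v" for i
  proof -
    have "d * i \<le> d * v" using that assms by (intro mult_left_mono) auto
    then have "d * i < l" using assms(7) by linarith
    then have "(d * i) mod l = d * i" using that assms by (intro mod_pos_pos_trivial) auto
    then show ?thesis by (simp add: mult.commute)
  qed
  have negative: "(- i * d) mod l = l - d * i" if "1 \<le> i" "i \<le> u" for i
  proof -
    have "d * i \<le> d * u" using that assms by (intro mult_left_mono) auto
    then have "d * i < l" using assms(6) by linarith
    moreover have "0 < d * i" using that assms by simp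
    ultimately have "(l - d * i) mod l = l - d * i" using assms by (intro mod_pos_pos_trivial) auto
    moreover have "(- i * d) mod l = (l - d * i) mod l" by (simp add: mult.commute)
    ultimately show ?thesis by simp
  qed
  have image: "insert l ((\<lambda>i. (i * d) mod l) ` {- u..v}) =
      (\<lambda>i. d * i) ` {0..v} \<union> (\<lambda>i. l - d * i) ` {0..u}"
  proof -
    have "{- u..v} = {0..v} \<union> uminus ` {1..u}" using assms by auto
    moreover have "{0..u} = insert 0 {1..u}" using assms by auto
    moreover have "(\<lambda>i. (i * d) mod l) ` {0..v} = (\<lambda>i. d * i) ` {0..v}"
      using nonneg by (intro image_cong) auto
    moreover have "(\<lambda>i. (i * d) mod l) ` uminus ` {1..u} = (\<lambda>i. l - d * i) ` {1..u}"
      unfolding image_image using negative by (intro image_cong) auto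
    ultimately show ?thesis by (simp add: image_Un)
  qed
  show ?thesis
  proof
    assume "dilated_interval l d u v T"
    then show "A = (\<lambda>i. d * i) ` {0..v} \<union> (\<lambda>i. l - d * i) ` {0..u}"
      using dilated_interval_residues[OF _ T_periodic] A_eq image by simp
  next
    assume A: "A = (\<lambda>i. d * i) ` {0..v} \<union> (\<lambda>i. l - d * i) ` {0..u}"
    have "i * d \<in> T \<longleftrightarrow> i \<le> v" if i: "- u \<le> i" "i < l - u" for i
    proof -
      have "i * d \<in> T \<longleftrightarrow> (i * d) mod l \<in> A" by (simp add: T_def)
      also have "\<dots> \<longleftrightarrow> (i * d) mod l \<in> (\<lambda>i. (i * d) mod l) ` {- u..v}"
        unfolding A image[symmetric] using pos_mod_bound[OF l_pos, of "i * d"] by simp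
      also have "\<dots> \<longleftrightarrow> (\<exists>j\<in>{- u..v}. [i * d = j * d] (mod l))" by (auto simp: cong_def)
      also have "\<dots> \<longleftrightarrow> (\<exists>j\<in>{- u..v}. [i = j] (mod l))"
        using cong_mult_rcancel[OF assms(1)] by blast
      also have "\<dots> \<longleftrightarrow> i \<le> v"
      proof
        assume "\<exists>j\<in>{- u..v}. [i = j] (mod l)"
        then obtain j where j: "- u \<le> j" "j \<le> v" "[i = j] (mod l)" by auto
        have "\<bar>i - j\<bar> < l" using i j l by linarith
        then have "i = j" using j(3) cong_int_bound by blast
        then show "i \<le> v" using j by simp
      qed (use i in \<open>auto intro!: bexI[of _ i]\<close>)
      finally show ?thesis .
    qed
    then show "dilated_interval l d u v T" using assms l by (simp add: dilated_interval_def)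
  qed
qed

end

lemma decreasing_progression:
  fixes m :: int
  shows "(\<lambda>i. d * m - c - d * i) ` {0..m - v - 1} = {d * j - c |j. j \<in> {v + 1..m}}"
proof (intro equalityI subsetI)
  fix x assume "x \<in> (\<lambda>i. d * m - c - d * i) ` {0..m - v - 1}"
  then obtain i where "0 \<le> i" "i \<le> m - v - 1" "x = d * m - c - d * i" by auto
  then have "x = d * (m - i) - c" "m - i \<in> {v + 1..m}" by (simp_all add: algebra_simps)
  then show "x \<in> {d * j - c |j. j \<in> {v + 1..m}}" by blast
next
  fix x assume "x \<in> {d * j - c |j. j \<in> {v + 1..m}}"
  then obtain j where "v + 1 \<le> j" "j \<le> m" "x = d * j - c" by auto
  then have "x = d * m - c - d * (m - j)" "m - j \<in> {0..m - v - 1}" by (simp_all add: algebra_simps)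
  then show "x \<in> (\<lambda>i. d * m - c - d * i) ` {0..m - v - 1}" by blast
qed

lemma progression_image: "{d * i |i. i \<in> {0..v}} = (\<lambda>i. d * i) ` {0..v::int}"
  by auto

lemma le_real_quotient_iff:
  fixes i m n :: int
  assumes "n > 0"
  shows "real_of_int i \<le> real_of_int m / real_of_int n \<longleftrightarrow> n * i \<le> m"
    and "real_of_int i < real_of_int m / real_of_int n \<longleftrightarrow> n * i < m"
    and "real_of_int m / real_of_int n < real_of_int i \<longleftrightarrow> m < n * i"
proof -
  have n: "real_of_int n > 0" using assms by simp
  have "n * i \<le> m \<longleftrightarrow> real_of_int (n * i) \<le> real_of_int m" by (simp only: of_int_le_iff)
  then show "real_of_int i \<le> real_of_int m / real_of_int n \<longleftrightarrow> n * i \<le> m"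
    using n by (simp add: field_simps)
  have "n * i < m \<longleftrightarrow> real_of_int (n * i) < real_of_int m" by (simp only: of_int_less_iff)
  then show "real_of_int i < real_of_int m / real_of_int n \<longleftrightarrow> n * i < m"
    using n by (simp add: field_simps)
  have "m < n * i \<longleftrightarrow> real_of_int m < real_of_int (n * i)" by (simp only: of_int_less_iff)
  then show "real_of_int m / real_of_int n < real_of_int i \<longleftrightarrow> m < n * i"
    using n by (simp add: field_simps)
qed

lemma real_quotient_bounds:
  fixes i :: int and k :: nat
  shows "real_of_int i \<le> (real k - 2) / 2 \<longleftrightarrow> 2 * i \<le> int k - 2"
    and "real_of_int i \<le> (2 * real k - 3) / 3 \<longleftrightarrow> 3 * i \<le> 2 * int k - 3"
    and "real_of_int i \<le> (real k - 3) / 3 \<longleftrightarrow> 3 * i \<le> int k - 3"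
    and "real_of_int i < (2 * real k - 3) / 3 \<longleftrightarrow> 3 * i < 2 * int k - 3"
    and "(real k - 3) / 3 < real_of_int i \<longleftrightarrow> int k - 3 < 3 * i"
  using le_real_quotient_iff(1)[of 2 i "int k - 2"] le_real_quotient_iff(1)[of 3 i "2 * int k - 3"]
    le_real_quotient_iff(1)[of 3 i "int k - 3"] le_real_quotient_iff(2)[of 3 i "2 * int k - 3"]
    le_real_quotient_iff(3)[of 3 "int k - 3" i] by simp_all

text \<open>The second progression on the left consists of \<open>4 * i - 3\<close> with \<open>1 \<le> i \<le> w + 1\<close>; its top element is listed separately.\<close>

lemma quadruple_progressions:
  fixes w :: int
  assumes "w \<ge> 0"
  shows "(\<lambda>i. 4 * i) ` {0..w} \<union> (\<lambda>i. (4 * w + 1) - 4 * i) ` {0..w} =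
    {0, 4 * w + 1} \<union> {4 * i |i. 1 \<le> i \<and> i \<le> w} \<union> {4 * i - 3 |i. 1 \<le> i \<and> i \<le> w}"
proof -
  have split: "{0..w} = insert 0 {1..w}" using assms by auto
  have "(\<lambda>i. (4 * w + 1) - 4 * i) ` {1..w} = {4 * i - 3 |i. 1 \<le> i \<and> i \<le> w}"
  proof (intro equalityI subsetI)
    fix x assume "x \<in> (\<lambda>i. (4 * w + 1) - 4 * i) ` {1..w}"
    then obtain i where "1 \<le> i" "i \<le> w" "x = 4 * w + 1 - 4 * i" by auto
    then have "x = 4 * (w + 1 - i) - 3 \<and> 1 \<le> w + 1 - i \<and> w + 1 - i \<le> w" by simp
    then show "x \<in> {4 * i - 3 |i. 1 \<le> i \<and> i \<le> w}" by blast
  next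
    fix x assume "x \<in> {4 * i - 3 |i. 1 \<le> i \<and> i \<le> w}"
    then obtain i where "1 \<le> i" "i \<le> w" "x = 4 * i - 3" by auto
    then have "x = 4 * w + 1 - 4 * (w + 1 - i)" "w + 1 - i \<in> {1..w}" by simp_all
    then show "x \<in> (\<lambda>i. (4 * w + 1) - 4 * i) ` {1..w}" by blast
  qed
  moreover have "(\<lambda>i. 4 * i) ` {1..w} = {4 * i |i. 1 \<le> i \<and> i \<le> w}" by auto
  ultimately show ?thesis unfolding split by auto
qed

context endpoint_set
begin

text \<open>The four families are the multipliers \<open>1, 2, 3, 4\<close>, with \<open>v\<close> as the parameter \<open>\<theta>\<close> in the second and third family
  and \<open>\<theta> = l - u\<close> in the first. For the multiplier \<open>4\<close>, the bounds \<open>4 * u < l\<close> and \<open>4 * v < l\<close> together with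
  \<open>l = 2 * u + 2 * v + 1\<close> leave only \<open>u = v\<close>. Coprimality of the multiplier and \<open>l\<close> is a condition for \<open>3\<close> only,
  because \<open>l\<close> is odd.\<close>

lemma small_dilation_iff:
  "small_dilation l T \<longleftrightarrow> k \<ge> 4 \<and>
    ((\<exists>\<theta>::int. int k \<le> \<theta> \<and> \<theta> \<le> 2 * int k - 4 \<and>
        A = {0..\<theta> - int k + 1} \<union> {\<theta>..2 * int k - 3})
     \<or> (\<exists>\<theta>::int. 1 \<le> \<theta> \<and> \<theta> \<le> int k - 3 \<and>
        A = {2 * i | i. i \<in> {0..\<theta>}} \<union> {2 * j - 1 | j. j \<in> {\<theta> + 1..int k - 1}})
     \<or> (\<not> 3 dvd k \<and>
        (\<exists>\<theta>::int. (real k - 3) / 3 < real_of_int \<theta> \<and> real_of_int \<theta> < (2 * real k - 3) / 3 \<and>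
          A = {3 * i | i. i \<in> {0..\<theta>}} \<union> {3 * j - int k | j. j \<in> {\<theta> + 1..int k - 1}}))
     \<or> (2 dvd k \<and>
        A = {0, 2 * int k - 3}
          \<union> {4 * i | i::int. 1 \<le> i \<and> real_of_int i \<le> (real k - 2) / 2}
          \<union> {4 * i - 3 | i::int. 1 \<le> i \<and> real_of_int i \<le> (real k - 2) / 2}))"
  (is "_ \<longleftrightarrow> _ \<and> (?a \<or> ?b \<or> ?c \<or> ?d)")
proof -
  define D where "D d u v = (\<lambda>i. d * i) ` {0..v} \<union> (\<lambda>i. l - d * i) ` {0..u}" for d u v
  have D1: "D 1 u v = {0..\<theta> - int k + 1} \<union> {\<theta>..2 * int k - 3}"
    if "u = l - \<theta>" "v = \<theta> - int k + 1" for u v \<theta>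
    using that by (simp add: D_def l_def)
  have D2: "D 2 u v = {2 * i | i. i \<in> {0..v}} \<union> {2 * j - 1 | j. j \<in> {v + 1..int k - 1}}"
    if "u + v = int k - 2" for u v
  proof -
    have "u = int k - 1 - v - 1" "l = 2 * (int k - 1) - 1" using that l_def by simp_all
    then show ?thesis using decreasing_progression[of 2 "int k - 1" 1 v] by (simp only: D_def progression_image)
  qed
  have D3: "D 3 u v = {3 * i | i. i \<in> {0..v}} \<union> {3 * j - int k | j. j \<in> {v + 1..int k - 1}}"
    if "u + v = int k - 2" for u v
  proof -
    have "u = int k - 1 - v - 1" "l = 3 * (int k - 1) - int k" using that l_def by simp_all
    then show ?thesis using decreasing_progression[of 3 "int k - 1" "int k" v] by (simp only: D_def progression_image)
  qed
  have D4: "D 4 w w = {0, 2 * int k - 3}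
          \<union> {4 * i | i::int. 1 \<le> i \<and> real_of_int i \<le> (real k - 2) / 2}
          \<union> {4 * i - 3 | i::int. 1 \<le> i \<and> real_of_int i \<le> (real k - 2) / 2}"
    if "2 * w = int k - 2" for w
  proof -
    have "l = 4 * w + 1" "2 * int k - 3 = 4 * w + 1" using that l_def by simp_all
    moreover have "2 * i \<le> int k - 2 \<longleftrightarrow> i \<le> w" for i using that by linarith
    moreover have "0 \<le> w" using that k_ge_3 by linarith
    ultimately show ?thesis
      unfolding real_quotient_bounds using quadruple_progressions[of w] by (simp only: D_def)
  qed
  have cop3: "coprime 3 l \<longleftrightarrow> \<not> 3 dvd k"
  proof -
    have "prime (3 :: int)" by simp
    then have "\<not> 3 dvd l \<Longrightarrow> coprime 3 l" by (rule prime_imp_coprime)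
    moreover have "\<not> 3 dvd l" if "coprime 3 l"
    proof
      assume "3 dvd l"
      then have "(3 :: int) dvd 1" using coprime_common_divisor[OF that, of 3] by simp
      then show False by simp
    qed
    ultimately have "coprime 3 l \<longleftrightarrow> \<not> 3 dvd l" by blast
    then show ?thesis unfolding l_def by presburger
  qed
  note dilI = dilated_interval_iff[folded D_def]
  show ?thesis
  proof
    assume "small_dilation l T"
    then obtain d u v where dil: "dilated_interval l d u v T" and d: "1 \<le> d" "d \<le> 4" "d * u < l" "d * v < l"
      by (auto simp: small_dilation_def)
    have uv: "1 \<le> u" "1 \<le> v" "u + v = int k - 2" and cop: "coprime d l"
      using dil l_def by (auto simp: dilated_interval_def)
    then have "k \<ge> 4" by linarith
    have A: "A = D d u v" using dilI[of d u v] dil d uv cop by simp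
    consider "d = 1" | "d = 2" | "d = 3" | "d = 4" using d by linarith
    then have "?a \<or> ?b \<or> ?c \<or> ?d"
    proof cases
      case 1
      have "int k \<le> l - u \<and> l - u \<le> 2 * int k - 4" using uv l_def by linarith
      moreover have "A = {0..(l - u) - int k + 1} \<union> {l - u..2 * int k - 3}"
        using A D1[of u "l - u" v] 1 uv l_def by simp
      ultimately show ?thesis by blast
    next
      case 2
      have "1 \<le> v \<and> v \<le> int k - 3" using uv by linarith
      then show ?thesis using A D2[OF uv(3)] 2 by blast
    next
      case 3
      have "int k - 3 < 3 * v \<and> 3 * v < 2 * int k - 3" using d uv l_def unfolding 3 by linarith
      then have ?c unfolding real_quotient_bounds using A D3[OF uv(3)] cop cop3 3 by blast
      then show ?thesis by blast
    next
      case 4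
      have "2 * u = int k - 2" "v = u" using d uv l_def unfolding 4 by linarith+
      then have ?d using A D4[of u] 4 by presburger
      then show ?thesis by blast
    qed
    then show "k \<ge> 4 \<and> (?a \<or> ?b \<or> ?c \<or> ?d)" using \<open>k \<ge> 4\<close> by blast
  next
    have smallI: "small_dilation l T"
      if "A = D d u v" "coprime d l" "1 \<le> u" "1 \<le> v" "u + v = int k - 2" "1 \<le> d" "d \<le> 4" "d * u < l" "d * v < l" for d u v
      using dilI[of d u v] that unfolding small_dilation_def by force
    assume "k \<ge> 4 \<and> (?a \<or> ?b \<or> ?c \<or> ?d)"
    then have "k \<ge> 4" and "?a \<or> ?b \<or> ?c \<or> ?d" by blast+
    from this(2) show "small_dilation l T"
    proof (elim disjE)
      assume ?a
      then obtain \<theta> where \<theta>: "int k \<le> \<theta>" "\<theta> \<le> 2 * int k - 4"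
        "A = {0..\<theta> - int k + 1} \<union> {\<theta>..2 * int k - 3}" by blast
      then show ?thesis using D1[of "l - \<theta>" \<theta> "\<theta> - int k + 1"] l_def
        by (intro smallI[of 1 "l - \<theta>" "\<theta> - int k + 1"]) auto
    next
      assume ?b
      then obtain \<theta> where \<theta>: "1 \<le> \<theta>" "\<theta> \<le> int k - 3"
        "A = {2 * i | i. i \<in> {0..\<theta>}} \<union> {2 * j - 1 | j. j \<in> {\<theta> + 1..int k - 1}}" by blast
      show ?thesis
      proof (rule smallI[of 2 "int k - 2 - \<theta>" \<theta>])
        show "A = D 2 (int k - 2 - \<theta>) \<theta>" using \<theta>(3) D2[of "int k - 2 - \<theta>" \<theta>] by simp
      qed (use \<theta>(1,2) l_def odd_l in auto)
    next
      assume c: ?c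
      then obtain \<theta> where \<theta>: "int k - 3 < 3 * \<theta>" "3 * \<theta> < 2 * int k - 3"
        "A = {3 * i | i. i \<in> {0..\<theta>}} \<union> {3 * j - int k | j. j \<in> {\<theta> + 1..int k - 1}}"
        unfolding real_quotient_bounds by blast
      show ?thesis
      proof (rule smallI[of 3 "int k - 2 - \<theta>" \<theta>])
        show "A = D 3 (int k - 2 - \<theta>) \<theta>" using \<theta>(3) D3[of "int k - 2 - \<theta>" \<theta>] by simp
        show "coprime 3 l" using c cop3 by blast
      qed (use \<theta>(1,2) l_def k_ge_3 in auto)
    next
      assume d: ?d
      then obtain m where m: "k = 2 * m" by blast
      define w where "w = int m - 1"
      have w: "2 * w = int k - 2" using m by (simp add: w_def)
      show ?thesis
      proof (rule smallI[of 4 w w])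
        show "A = D 4 w w" using d D4[OF w] by presburger
        show "coprime 4 l" using odd_l by (metis coprime_left_2_iff_odd coprime_power_left_iff mult_2 numeral_Bit0 power2_eq_square)
      qed (use w l_def \<open>k \<ge> 4\<close> in auto)
    qed
  qed
qed

lemma three_progressions_mem:
  "x \<in> {3 * i | i::int. 0 \<le> i \<and> real_of_int i \<le> (2 * real k - 3) / 3}
      \<union> {\<theta> + 3 * i | i::int. 0 \<le> i \<and> real_of_int i \<le> (real k - 3) / 3} \<longleftrightarrow>
    (0 \<le> x \<and> x \<le> l \<and> 3 dvd x) \<or> (\<theta> \<le> x \<and> x \<le> \<theta> + int k - 3 \<and> [x = \<theta>] (mod 3))"
  (is "_ \<in> ?P \<union> ?Q \<longleftrightarrow> ?R \<or> ?S")
proof -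
  have "x \<in> ?P \<longleftrightarrow> ?R" unfolding real_quotient_bounds l_def by (auto elim!: dvdE)
  moreover have "x \<in> ?Q \<longleftrightarrow> ?S"
  proof
    assume "x \<in> ?Q"
    then show ?S unfolding real_quotient_bounds by (auto simp: cong_iff_dvd_diff)
  next
    assume S: ?S
    then obtain i where i: "x - \<theta> = 3 * i" by (auto simp: cong_iff_dvd_diff)
    then have "x = \<theta> + 3 * i" "0 \<le> i" "3 * i \<le> int k - 3" using S by linarith+
    then show "x \<in> ?Q" unfolding real_quotient_bounds by blast
  qed
  ultimately show ?thesis by (simp only: Un_iff)
qed

definition three_progressions :: "int \<Rightarrow> bool" where
  "three_progressions \<theta> \<longleftrightarrow> 4 \<le> k \<and> 3 dvd k \<and> 1 \<le> \<theta> \<and> \<theta> \<le> int k - 1 \<and> \<not> 3 dvd \<theta> \<and>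
    (\<forall>x. 0 \<le> x \<and> x < l \<longrightarrow>
      (x \<in> T \<longleftrightarrow> 3 dvd x \<or> (\<theta> \<le> x \<and> x \<le> \<theta> + int k - 3 \<and> [x = \<theta>] (mod 3))))"

text \<open>The set on the right also contains \<open>l\<close>, as a multiple of \<open>3\<close>; the definition leaves it out because it describes residues.\<close>

lemma three_progressions_iff:
  "three_progressions \<theta> \<longleftrightarrow> 4 \<le> k \<and> 3 dvd k \<and> 1 \<le> \<theta> \<and> \<theta> \<le> int k - 1 \<and> \<not> 3 dvd \<theta> \<and>
    A = {3 * i | i::int. 0 \<le> i \<and> real_of_int i \<le> (2 * real k - 3) / 3}
      \<union> {\<theta> + 3 * i | i::int. 0 \<le> i \<and> real_of_int i \<le> (real k - 3) / 3}"
  (is "_ \<longleftrightarrow> _ \<and> _ \<and> _ \<and> _ \<and> _ \<and> A = ?E")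
proof (cases "4 \<le> k \<and> 3 dvd k \<and> 1 \<le> \<theta> \<and> \<theta> \<le> int k - 1 \<and> \<not> 3 dvd \<theta>")
  case True
  define F where "F x \<longleftrightarrow> 3 dvd x \<or> (\<theta> \<le> x \<and> x \<le> \<theta> + int k - 3 \<and> [x = \<theta>] (mod 3))" for x
  have "3 dvd l" using True unfolding l_def by presburger
  moreover have "\<theta> + int k - 3 < l" using True l_def by linarith
  ultimately have E: "x \<in> ?E \<longleftrightarrow> x = l \<or> (0 \<le> x \<and> x < l \<and> F x)" for x
    unfolding three_progressions_mem F_def using True l_pos by auto
  have "(\<forall>x. 0 \<le> x \<and> x < l \<longrightarrow> (x \<in> T \<longleftrightarrow> F x)) \<longleftrightarrow> A = ?E"
  proof
    assume "\<forall>x. 0 \<le> x \<and> x < l \<longrightarrow> (x \<in> T \<longleftrightarrow> F x)"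
    then have "x \<in> A \<longleftrightarrow> x = l \<or> (0 \<le> x \<and> x < l \<and> F x)" for x
      by (subst A_eq) auto
    then show "A = ?E" using E by blast
  next
    assume "A = ?E"
    then have "x \<in> A \<longleftrightarrow> x = l \<or> (0 \<le> x \<and> x < l \<and> F x)" for x by (simp only: E)
    then show "\<forall>x. 0 \<le> x \<and> x < l \<longrightarrow> (x \<in> T \<longleftrightarrow> F x)" using mem_T_iff by simp
  qed
  then show ?thesis using True unfolding three_progressions_def F_def by blast
next
  case False
  then show ?thesis unfolding three_progressions_def by blast
qed

text \<open>The unrepresented gaps are the doubles of the two ends \<open>\<theta>\<close> and \<open>M = \<theta> + k - 3\<close> of the partial class. A missing
  \<open>c\<close> in the class of \<open>\<theta>\<close> is represented by an element of the partial class and a multiple of \<open>3\<close>, and its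
  carry is decided by the side of the partial class on which it lies. A missing \<open>c\<close> in the class of \<open>2 * \<theta>\<close> is a
  sum of two elements of the partial class, and all these sums lie within one period.\<close>

lemma card_sumset_three_progressions:
  assumes "three_progressions \<theta>"
  shows "int (card (restricted_sumset A)) = 3 * int k - 7"
proof -
  have "k \<ge> 4" and k3: "3 dvd k" and \<theta>: "1 \<le> \<theta>" "\<theta> \<le> int k - 1" "\<not> 3 dvd \<theta>"
    and mem: "\<And>x. \<lbrakk>0 \<le> x; x < l\<rbrakk> \<Longrightarrow>
      x \<in> T \<longleftrightarrow> 3 dvd x \<or> (\<theta> \<le> x \<and> x \<le> \<theta> + int k - 3 \<and> [x = \<theta>] (mod 3))"
    using assms by (auto simp: three_progressions_def)
  have l3: "3 dvd l" using k3 unfolding l_def by presburger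
  have "k \<ge> 6" using k3 \<open>k \<ge> 4\<close> by presburger
  have mod3: "[x mod l = x] (mod 3)" for x using l3 by (simp add: cong_def mod_mod_cancel)
  have T_iff: "x \<in> T \<longleftrightarrow> 3 dvd x \<or> (\<theta> \<le> x mod l \<and> x mod l \<le> \<theta> + int k - 3 \<and> [x = \<theta>] (mod 3))" for x
  proof -
    have "x \<in> T \<longleftrightarrow> x mod l \<in> T" using periodic_mod[OF T_periodic] by simp
    moreover have "3 dvd x mod l \<longleftrightarrow> 3 dvd x" using mod3 by (rule cong_dvd_iff)
    moreover have "[x mod l = \<theta>] (mod 3) \<longleftrightarrow> [x = \<theta>] (mod 3)" using mod3 cong_sym cong_trans by blast
    ultimately show ?thesis using mem[of "x mod l"] l_pos by simp
  qed
  have both: "\<theta> \<le> x mod l \<and> x mod l \<le> \<theta> + int k - 3 \<and> \<theta> \<le> (c - x) mod l \<and> (c - x) mod l \<le> \<theta> + int k - 3"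
    if "[c = 2 * \<theta>] (mod 3)" "x \<in> T" "c - x \<in> T" for c x
  proof -
    have "\<not> 3 dvd x"
    proof
      assume "3 dvd x"
      then have "[c - x = 2 * \<theta>] (mod 3)" using cong_diff[OF that(1), of x 0] by (simp add: cong_0_iff)
      then have "\<not> 3 dvd c - x" "\<not> [c - x = \<theta>] (mod 3)"
        using \<theta>(3) unfolding cong_iff_dvd_diff by presburger+
      then show False using that(3) T_iff by blast
    qed
    moreover from this have "[x = \<theta>] (mod 3)" using that(2) T_iff by blast
    then have "[c - x = 2 * \<theta> - \<theta>] (mod 3)" using that(1) by (intro cong_diff)
    then have "\<not> 3 dvd c - x" using \<theta>(3) by (simp add: cong_dvd_iff)
    ultimately show ?thesis using that(2,3) T_iff by blast
  qed
  have sum_cong: "[x mod l + (c - x) mod l = c] (mod l)" for c x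
    by (simp add: cong_def mod_add_eq)
  have not_T: "c \<notin> T" if "[c = 2 * \<theta>] (mod 3)" for c
  proof -
    have "\<not> 3 dvd c" "\<not> [c = \<theta>] (mod 3)" using that \<theta>(3) unfolding cong_iff_dvd_diff by presburger+
    then show ?thesis using T_iff by blast
  qed
  define M where "M = \<theta> + int k - 3"
  have c1: "[2 * \<theta> = 2 * \<theta>] (mod 3)" by simp
  have c2: "[2 * M = 2 * \<theta>] (mod 3)" using k3 unfolding M_def cong_iff_dvd_diff by presburger
  show ?thesis
  proof (rule card_sumsetI)
    show "2 * \<theta> \<notin> T" "2 * M \<notin> T" using not_T c1 c2 by blast+
    show "\<not> [2 * \<theta> = 2 * M] (mod l)"
    proof
      assume "[2 * \<theta> = 2 * M] (mod l)"
      then have "2 * \<theta> = 2 * M" using l_def \<open>k \<ge> 6\<close> by (intro cong_int_bound) (auto simp: M_def)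
      then show False using \<open>k \<ge> 6\<close> by (simp add: M_def)
    qed
    show "unrepresented l T (2 * \<theta>)"
      unfolding unrepresented_def
    proof (intro ballI impI)
      fix x assume x: "x \<in> T" "2 * \<theta> - x \<in> T"
      note bounds = both[OF c1 x]
      have "x mod l + (2 * \<theta> - x) mod l = 2 * \<theta>"
        using bounds l_def \<open>k \<ge> 6\<close> by (intro cong_int_bound[OF sum_cong]) linarith
      then have "x mod l = \<theta>" using bounds by linarith
      then have "[x = \<theta>] (mod l)" by (auto simp: cong_def)
      then show "[2 * x = 2 * \<theta>] (mod l)" by (rule cong_scalar_left)
    qed
    show "unrepresented l T (2 * M)"
      unfolding unrepresented_def
    proof (intro ballI impI)
      fix x assume x: "x \<in> T" "2 * M - x \<in> T"
      note bounds = both[OF c2 x]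
      have "x mod l + (2 * M - x) mod l = 2 * M"
        using bounds l_def M_def \<open>k \<ge> 6\<close> by (intro cong_int_bound[OF sum_cong]) linarith
      then have "x mod l = M" using bounds M_def by linarith
      then have "[x = M] (mod l)" by (metis cong_mod_left cong_refl)
      then show "[2 * x = 2 * M] (mod l)" by (rule cong_scalar_left)
    qed
    show "one_sided l T"
    proof (rule one_sidedI[OF l_pos T_periodic])
      fix c x y assume cxy: "c \<notin> T" "x \<in> T" "c - x \<in> T" "y \<in> T" "c - y \<in> T"
      consider "[c = \<theta>] (mod 3)" | "[c = 2 * \<theta>] (mod 3)" 
      proof -
        have "\<not> 3 dvd c" using cxy(1) T_iff by blast
        then have "[c = \<theta>] (mod 3) \<or> [c = 2 * \<theta>] (mod 3)" using \<theta>(3) unfolding cong_iff_dvd_diff by presburger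
        then show ?thesis using that by blast
      qed
      then show "x mod l + (c - x) mod l = y mod l + (c - y) mod l"
      proof cases
        case 1
        have C: "0 \<le> c mod l" "c mod l < l" "c mod l < \<theta> \<or> \<theta> + int k - 3 < c mod l"
          using 1 cxy(1) T_iff[of c] l_pos by auto
        have "z mod l + (c - z) mod l = c mod l + (if c mod l < \<theta> then l else 0)"
          if z: "z \<in> T" "c - z \<in> T" for z
        proof -
          have range: "0 \<le> z mod l" "z mod l < l" "0 \<le> (c - z) mod l" "(c - z) mod l < l"
            using l_pos by simp_all
          have "c mod l = (z mod l + (c - z) mod l) mod l" by (simp add: mod_add_eq)
          then have sum: "c mod l = (if z mod l + (c - z) mod l < l
              then z mod l + (c - z) mod l else z mod l + (c - z) mod l - l)"
            using range by (simp only: mod_add_residues)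
          have "(\<theta> \<le> z mod l \<and> z mod l \<le> \<theta> + int k - 3) \<or>
              (\<theta> \<le> (c - z) mod l \<and> (c - z) mod l \<le> \<theta> + int k - 3)"
          proof (rule ccontr)
            assume "\<not> ?thesis"
            then have "3 dvd z" "3 dvd c - z" using z T_iff by blast+
            then have "3 dvd z + (c - z)" by (rule dvd_add)
            then show False using cxy(1) T_iff by simp
          qed
          then show ?thesis using sum range C by (smt (verit))
        qed
        then show ?thesis using cxy by simp
      next
        case 2
        note bounds = both[OF 2 cxy(2,3)] both[OF 2 cxy(4,5)]
        have "[x mod l + (c - x) mod l = y mod l + (c - y) mod l] (mod l)"
          using sum_cong cong_sym cong_trans by blast
        then show ?thesis using bounds l_def by (elim cong_int_bound) linarith
      qed
    qed
  qed
qed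

end

section \<open>The characterisation\<close>

context endpoint_set
begin

text \<open>In the case \<open>g = 1\<close> the interval is turned so that \<open>u \<le> v\<close>, replacing \<open>d\<close> by \<open>- d\<close> if necessary.\<close>

lemma extremal_cases:
  assumes "int (card (restricted_sumset A)) = 3 * int k - 7"
  shows "small_dilation l T \<or> (\<exists>\<theta>. three_progressions \<theta>) \<or> A \<in> exceptional_sets"
proof -
  obtain h e where "extremal l T h e" using assms by (rule card_sumset_imp_extremal)
  then interpret E: extremal l T h e .
  show ?thesis
  proof (cases "E.g = 1")
    case True
    then obtain u v where "dilated_interval l (2 * e) u v T" by (rule E.dilated_interval_if_generator)
    then obtain d u v where dil: "dilated_interval l d u v T" and "u \<le> v"
      using dilated_interval_flip[OF T_periodic] by (metis linear)
    show ?thesis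
    proof (cases "v \<ge> 6")
      case True
      then show ?thesis
        using long_dilated_interval[OF T_periodic E.sided dil \<open>u \<le> v\<close>] by blast
    next
      case False
      then have "small_dilation l T \<or> insert l (T \<inter> {0..<l}) \<in> set ` set sporadic_sets"
        using short_dilated_interval[OF T_periodic E.sided dil \<open>u \<le> v\<close>] by simp
      then show ?thesis using A_eq unfolding exceptional_sets_eq by auto
    qed
  next
    case False
    then have "E.g > 1" using E.g_pos by linarith
    then interpret C: extremal_cosets l T h e by unfold_locales
    show ?thesis
      using C.g_cases
    proof (elim disjE conjE)
      assume "E.g = 3"
      then obtain \<theta> where \<theta>: "1 \<le> \<theta>" "\<not> 3 dvd \<theta>" "l = 3 * E.n" "\<theta> + 3 * ((E.n - 1) div 2) < l"
        "\<And>x. \<lbrakk>0 \<le> x; x < l\<rbrakk> \<Longrightarrow>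
          x \<in> T \<longleftrightarrow> 3 dvd x \<or> (\<theta> \<le> x \<and> x \<le> \<theta> + 3 * ((E.n - 1) div 2) \<and> [x = \<theta>] (mod 3))"
        using C.three_cosets by blast
      have "3 dvd k" using \<theta>(3) l_def by presburger
      moreover have half: "3 * ((E.n - 1) div 2) = int k - 3"
      proof -
        obtain r where "E.n = 2 * r + 1" using E.odd_n by (rule oddE)
        then show ?thesis using \<theta>(3) l_def by simp
      qed
      moreover have "\<theta> \<le> int k - 1" using \<theta>(4) half l_def by linarith
      moreover have "k \<ge> 4" using \<theta>(3) l_def E.n_ge_3 by linarith
      moreover have last: "\<theta> + 3 * ((E.n - 1) div 2) = \<theta> + int k - 3" using half by linarith
      ultimately have "three_progressions \<theta>"
        using \<theta>(1,2) \<theta>(5)[unfolded last] unfolding three_progressions_def by blast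
      then show ?thesis by blast
    next
      assume "E.g = 5" "E.n = 3"
      then obtain p \<theta> where p: "l = 15" "1 \<le> p" "p \<le> 4" "\<theta> = p \<or> \<theta> = p + 5"
        and mem: "\<And>x. \<lbrakk>0 \<le> x; x < 15\<rbrakk> \<Longrightarrow> x \<in> T \<longleftrightarrow> 5 dvd x \<or> 5 dvd x + p \<or> x = \<theta> \<or> x = \<theta> + 5"
        using C.five_cosets by blast
      have "A = set (filter (\<lambda>x. x = 15 \<or> 5 dvd x \<or> 5 dvd x + p \<or> x = \<theta> \<or> x = \<theta> + 5) [0..15])"
        (is "_ = set (filter ?P _)")
      proof -
        have "x \<in> A \<longleftrightarrow> 0 \<le> x \<and> x \<le> 15 \<and> ?P x" for x
        proof (cases "0 \<le> x \<and> x < 15")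
          case True
          then show ?thesis using mem[of x] mem_T_iff[of x] p(1) by auto
        next
          case False
          then show ?thesis using A_sub l_A p(1) by auto
        qed
        then show ?thesis by auto
      qed
      moreover have "p \<in> set [1..4]" "\<theta> \<in> set [p, p + 5]" using p by auto
      note bspec[OF bspec[OF five_coset_check this(1)] this(2)]
      ultimately have "A \<in> set ` set five_coset_sets" by (metis imageI)
      then show ?thesis unfolding exceptional_sets_eq by auto
    qed
  qed
qed

lemma exceptional_card:
  assumes "A \<in> exceptional_sets"
  shows "k \<ge> 4" "int (card (restricted_sumset A)) = 3 * int k - 7"
proof -
  obtain xs where xs: "xs \<in> set (sporadic_sets @ five_coset_sets)" "A = set xs"
    using assms unfolding exceptional_sets_eq by blast
  then have check: "distinct xs" "4 \<le> length xs"
    "int (length (remdups [a + b. a \<leftarrow> xs, b \<leftarrow> xs, a < b])) = 3 * int (length xs) - 7"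
    using exceptional_card_check by blast+
  have k: "k = length xs" using card_A xs(2) check(1) by (simp add: distinct_card)
  have "restricted_sumset A = set [a + b. a \<leftarrow> xs, b \<leftarrow> xs, a < b]"
  proof -
    have "restricted_sumset A = {a + b |a b. a \<in> A \<and> b \<in> A \<and> a < b}"
      unfolding restricted_sumset_def by (metis (lifting) add.commute linorder_neqE order_less_irrefl)
    then show ?thesis unfolding xs(2) by auto
  qed
  then have "card (restricted_sumset A) = length (remdups [a + b. a \<leftarrow> xs, b \<leftarrow> xs, a < b])"
    by (simp only: length_remdups_card_conv)
  then show "k \<ge> 4" "int (card (restricted_sumset A)) = 3 * int k - 7" using check k by simp_all
qed

lemma card_sumset_eq_iff:
  "int (card (restricted_sumset A)) = 3 * int k - 7 \<longleftrightarrow>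
    small_dilation l T \<or> (\<exists>\<theta>. three_progressions \<theta>) \<or> A \<in> exceptional_sets"
proof
  assume "small_dilation l T \<or> (\<exists>\<theta>. three_progressions \<theta>) \<or> A \<in> exceptional_sets"
  then show "int (card (restricted_sumset A)) = 3 * int k - 7"
  proof (elim disjE exE)
    assume "small_dilation l T"
    then obtain d u v where "dilated_interval l d u v T" "1 \<le> d" "d * u < l" "d * v < l"
      by (auto simp: small_dilation_def)
    then show ?thesis using card_sumset_small_dilation[of d u v] by simp
  qed (simp_all add: card_sumset_three_progressions exceptional_card(2))
qed (rule extremal_cases)

end

theorem theorem1p3:
  fixes k :: nat and a :: "nat \<Rightarrow> int" and A :: "int set"
  assumes "k \<ge> 3"
    and "A = a ` {0..k - 1}"
    and "strict_mono_on {0..k - 1} a"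
    and "a 0 = 0"
    and "a (k - 1) = 2 * int k - 3"
  shows "int (card (restricted_sumset A)) = 3 * int k - 7 \<longleftrightarrow>
    k \<ge> 4 \<and>
    ((\<exists>\<theta>::int. int k \<le> \<theta> \<and> \<theta> \<le> 2 * int k - 4 \<and>
        A = {0..\<theta> - int k + 1} \<union> {\<theta>..2 * int k - 3})
     \<or> (\<exists>\<theta>::int. 1 \<le> \<theta> \<and> \<theta> \<le> int k - 3 \<and>
        A = {2 * i | i. i \<in> {0..\<theta>}} \<union> {2 * j - 1 | j. j \<in> {\<theta> + 1..int k - 1}})
     \<or> (\<not> 3 dvd k \<and>
        (\<exists>\<theta>::int. (real k - 3) / 3 < real_of_int \<theta> \<and> real_of_int \<theta> < (2 * real k - 3) / 3 \<and>
          A = {3 * i | i. i \<in> {0..\<theta>}} \<union> {3 * j - int k | j. j \<in> {\<theta> + 1..int k - 1}}))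
     \<or> (2 dvd k \<and>
        A = {0, 2 * int k - 3}
          \<union> {4 * i | i::int. 1 \<le> i \<and> real_of_int i \<le> (real k - 2) / 2}
          \<union> {4 * i - 3 | i::int. 1 \<le> i \<and> real_of_int i \<le> (real k - 2) / 2})
     \<or> (3 dvd k \<and>
        (\<exists>\<theta>::int. 1 \<le> \<theta> \<and> \<theta> \<le> int k - 1 \<and> \<not> 3 dvd \<theta> \<and>
          A = {3 * i | i::int. 0 \<le> i \<and> real_of_int i \<le> (2 * real k - 3) / 3}
            \<union> {\<theta> + 3 * i | i::int. 0 \<le> i \<and> real_of_int i \<le> (real k - 3) / 3}))
     \<or> A \<in> exceptional_sets)"
proof -
  have mono: "a i \<le> a j" if "i \<le> j" "j \<le> k - 1" for i j
  proof (cases "i = j")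
    case False
    then have "a i < a j" using that by (intro strict_mono_onD[OF assms(3)]) auto
    then show ?thesis by simp
  qed simp
  interpret endpoint_set k A "2 * int k - 3"
  proof
    have "inj_on a {0..k - 1}" using assms(3) by (rule strict_mono_on_imp_inj_on)
    then show "card A = k" using assms(1,2) by (simp add: card_image)
    show "A \<subseteq> {0..2 * int k - 3}"
      using mono[of 0] mono[of _ "k - 1"] assms by auto
    show "0 \<in> A" "2 * int k - 3 \<in> A" using assms(1,2,4,5) by (auto intro: image_eqI[of _ a 0] image_eqI[of _ a "k - 1"])
  qed (use assms in auto)
  show ?thesis
    unfolding card_sumset_eq_iff small_dilation_iff three_progressions_iff
    using exceptional_card(1) by blast
qed

end
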